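(* Let $a\in\{cc,cs,cf,ss\}$. There is a constant $C>0$ such that for every $t\in[0,1]$, every partition $\mathcal{T}$ of $I=(0,1)$ and every $f\in L_2(I)$ the following holds. There exists a unique $(u,M,\hat q)\in U_a(t)$ such that $$b_t\bigl((u,M,\hat q),(z,W)\bigr)=L_f(z,W)\qquad\forall (z,W)\in V.$$ It satisfies $$\|(u,M,\hat q)\|_U\le C\,\|f\|$$ (so that $C$ is independent of $\mathcal{T}$, $f$ and $t$). Furthermore, $u,M\in H^2(I)$, the pair $(u,M)$ solves $$-M''=f,\qquad M-t^2M''+u''=0\qquad\text{in } I,$$ and $\hat q=\gamma_h(u,M)$.
   Context: All functions are real-valued; $I=(0,1)$; $(\cdot,\cdot)$ and $\|\cdot\|$ are the inner product and norm of $L_2(I)$; $\|\cdot\|_T$ is the $L_2(T)$-norm. Boundary conditions. For $t\in[0,1]$ define subspaces of $H^2(I)\times H^2(I)$ (c = clamped, s = supported, f = free): $\mathbb{H}^2_{cc}(t)=\{(u,M): u(0)=u'(0)-t^2M'(0)=u(1)=u'(1)-t^2M'(1)=0\}$, $\mathbb{H}^2_{cs}(t)=\{(u,M): u(0)=u'(0)-t^2M'(0)=u(1)=M(1)=0\}$, $\mathbb{H}^2_{cf}(t)=\{(u,M): u(0)=u'(0)-t^2M'(0)=M(1)=M'(1)=0\}$, $\mathbb{H}^2_{ss}(t)=\{(u,M): u(0)=M(0)=u(1)=M(1)=0\}$. Mesh. A partition is $\mathcal{T}=\{I_j=(x_{j-1},x_j): j=1,\ldots,n\}$ with $n\ge1$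 and $0=x_0<x_1<\dots<x_n=1$; $h_j=x_j-x_{j-1}$. $H^2(\mathcal{T})=\{v\in L_2(I): v_j:=v|_{I_j}\in H^2(I_j),\ j=1,\dots,n\}$, derivatives of such functions are taken piecewise, and $(\cdot,\cdot)_{\mathcal{T}}$ is the $L_2(I)$-inner product taken piecewise on $\mathcal{T}$. Traces. For $z\in H^2(I_j)$, $\gamma_j(z)=(z(x_{j-1}),z'(x_{j-1}),z(x_j),z'(x_j))$; for $z\in H^2(\mathcal{T})$, $\gamma_h(z)=(\gamma_j(z_j))_{j=1}^n$; $\gamma_h(u,M)=(\gamma_h(u),\gamma_h(M))$. Trace space: $\hat U_a(t)=\gamma_h(\mathbb{H}^2_a(t))$. With $[v\,w]_j:=v(x_j)w(x_j)-v(x_{j-1})w(x_{j-1})$, where point values are those of the restrictions to $I_j$, define for $u,M,z,W\in H^2(\mathcal{T})$ $$\langle\gamma_h(u,M),(z,W)\rangle_t=\sum_{j=1}^n\Bigl(-[u\,W']_j+[M'\,z]_j-[M\,(z'-t^2W')]_j+[(u'-t^2M')\,W]_j\Bigr),$$ and $\langle\hat q,(z,W)\rangle_t:=\langle\gamma_h(u,M),(z,W)\rangle_t$ for any $u,M\in H^2(I)$ with $\gamma_h(u,M)=\hat q$ (this depends only on $\hat q$). Trace norm. For $u\in H^2(I_j)$ and $\xi=(u(x_{j-1}),u(x_j),u'(x_{j-1}),u'(x_j))^{\top}$, $h=h_j$, set $\|\gamma_j(u)\|_j^2=\xi^{\top}(A+B)\xi$ with $$A=\frac h{420}\begin{pmatrix}156&54&22h&-13h\\54&156&13h&-22h\\22h&13h&4h^2&-3h^2\\-13h&-22h&-3h^2&4h^2\end{pmatrix},\quad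 B=\frac2{h^3}\begin{pmatrix}6&-6&3h&3h\\-6&6&-3h&-3h\\3h&-3h&2h^2&h^2\\3h&-3h&h^2&2h^2\end{pmatrix},$$ and, for $\hat q=\gamma_h(u,M)$ with $u,M\in H^2(I)$, $\|\hat q\|_h^2=\sum_{j=1}^n(\|\gamma_j(u_j)\|_j^2+\|\gamma_j(M_j)\|_j^2)$. Spaces and forms. $U_a(t)=L_2(I)\times L_2(I)\times\hat U_a(t)$ with $\|(u,M,\hat q)\|_U^2=\|u\|^2+\|M\|^2+\|\hat q\|_h^2$; $V=H^2(\mathcal{T})\times H^2(\mathcal{T})$ with $\|(z,W)\|_V^2=\|z\|^2+(z'',z'')_{\mathcal{T}}+\|W\|^2+(W'',W'')_{\mathcal{T}}$. Finally $L_f(z,W)=-(f,z)$ and $$b_t((u,M,\hat q),(z,W))=(u,W'')_{\mathcal{T}}+(M,W+z''-t^2W'')_{\mathcal{T}}+\langle\hat q,(z,W)\rangle_t.$$ *)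

theory Defs
  imports "HOL-Analysis.Analysis"
begin

text \<open>
  Elements of \<open>L\<^sub>2(J)\<close> are represented by functions \<open>real \<Rightarrow> real\<close>, whose values outside \<open>J\<close>
  are irrelevant; equality in \<open>L\<^sub>2(J)\<close> is the relation \<open>ae_eq J\<close>.
  In particular, the same function also represents its restriction to any subset of \<open>J\<close>.
\<close>

definition L2 :: "real set \<Rightarrow> (real \<Rightarrow> real) set" where
  "L2 J = {f. f \<in> borel_measurable (lebesgue_on J) \<and> integrable (lebesgue_on J) (\<lambda>x. (f x)\<^sup>2)}"

definition ae_eq :: "real set \<Rightarrow> (real \<Rightarrow> real) \<Rightarrow> (real \<Rightarrow> real) \<Rightarrow> bool" where
  "ae_eq J f g \<longleftrightarrow> (AE x in lebesgue_on J. f x = g x)"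

definition l2_inner :: "real set \<Rightarrow> (real \<Rightarrow> real) \<Rightarrow> (real \<Rightarrow> real) \<Rightarrow> real" where
  "l2_inner J f g = integral\<^sup>L (lebesgue_on J) (\<lambda>x. f x * g x)"

definition l2_norm :: "real set \<Rightarrow> (real \<Rightarrow> real) \<Rightarrow> real" where
  "l2_norm J f = sqrt (l2_inner J f f)"

definition test_fun :: "real set \<Rightarrow> (real \<Rightarrow> real) set" where
  "test_fun J = {\<phi>. (\<forall>k. (deriv ^^ k) \<phi> differentiable_on UNIV) \<and>
                    (\<exists>K. compact K \<and> K \<subseteq> J \<and> (\<forall>x. x \<notin> K \<longrightarrow> \<phi> x = 0))}"

definition is_weak_deriv :: "nat \<Rightarrow> real set \<Rightarrow> (real \<Rightarrow> real) \<Rightarrow> (real \<Rightarrow> real) \<Rightarrow> bool" where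
  "is_weak_deriv k J u g \<longleftrightarrow>
     (\<forall>\<phi>\<in>test_fun J. l2_inner J u ((deriv ^^ k) \<phi>) = (- 1) ^ k * l2_inner J g \<phi>)"

definition H2 :: "real set \<Rightarrow> (real \<Rightarrow> real) set" where
  "H2 J = {u \<in> L2 J. \<forall>k\<in>{1, 2}. \<exists>g\<in>L2 J. is_weak_deriv k J u g}"

text \<open>A representative of the \<open>k\<close>-th weak derivative, which is unique up to \<open>ae_eq J\<close>.\<close>

definition wderiv :: "nat \<Rightarrow> real set \<Rightarrow> (real \<Rightarrow> real) \<Rightarrow> real \<Rightarrow> real" where
  "wderiv k J u = (SOME g. g \<in> L2 J \<and> is_weak_deriv k J u g)"

text \<open>
  Point values are those of the representative that is continuous up to the boundary
  (it exists for functions in \<open>H\<^sup>2(J)\<close> and for their first derivatives, \<open>J\<close> a bounded open interval).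
\<close>

definition point_value :: "real set \<Rightarrow> (real \<Rightarrow> real) \<Rightarrow> real \<Rightarrow> real" where
  "point_value J u p =
     (THE y. \<exists>v. continuous_on (closure J) v \<and> ae_eq J v u \<and> v p = y)"

abbreviation unit_ivl :: "real set" where
  "unit_ivl \<equiv> {0<..<1}"

text \<open>Clamped, supported and free ends, for the left and the right end point.\<close>

datatype bc = CC | CS | CF | SS

definition H2_bc :: "bc \<Rightarrow> real \<Rightarrow> ((real \<Rightarrow> real) \<times> (real \<Rightarrow> real)) set" where
  "H2_bc a t = {(u, M). u \<in> H2 unit_ivl \<and> M \<in> H2 unit_ivl \<and>
     (let u0 = point_value unit_ivl u 0;
          u1 = point_value unit_ivl u 1;
          du0 = point_value unit_ivl (wderiv 1 unit_ivl u) 0;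
          du1 = point_value unit_ivl (wderiv 1 unit_ivl u) 1;
          M0 = point_value unit_ivl M 0;
          M1 = point_value unit_ivl M 1;
          dM0 = point_value unit_ivl (wderiv 1 unit_ivl M) 0;
          dM1 = point_value unit_ivl (wderiv 1 unit_ivl M) 1
      in case a of
           CC \<Rightarrow> u0 = 0 \<and> du0 - t\<^sup>2 * dM0 = 0 \<and> u1 = 0 \<and> du1 - t\<^sup>2 * dM1 = 0
         | CS \<Rightarrow> u0 = 0 \<and> du0 - t\<^sup>2 * dM0 = 0 \<and> u1 = 0 \<and> M1 = 0
         | CF \<Rightarrow> u0 = 0 \<and> du0 - t\<^sup>2 * dM0 = 0 \<and> M1 = 0 \<and> dM1 = 0
         | SS \<Rightarrow> u0 = 0 \<and> M0 = 0 \<and> u1 = 0 \<and> M1 = 0)}"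

text \<open>
  A partition is given by the number \<open>n\<close> of its elements and its nodes \<open>x 0, \<dots>, x n\<close>;
  values \<open>x j\<close> with \<open>j > n\<close> are irrelevant. Elements are numbered from \<open>1\<close> to \<open>n\<close>.
\<close>

definition is_mesh :: "nat \<Rightarrow> (nat \<Rightarrow> real) \<Rightarrow> bool" where
  "is_mesh n x \<longleftrightarrow> 1 \<le> n \<and> x 0 = 0 \<and> x n = 1 \<and> (\<forall>j\<in>{1..n}. x (j - 1) < x j)"

definition elem :: "(nat \<Rightarrow> real) \<Rightarrow> nat \<Rightarrow> real set" where
  "elem x j = {x (j - 1)<..<x j}"

definition H2_mesh :: "nat \<Rightarrow> (nat \<Rightarrow> real) \<Rightarrow> (real \<Rightarrow> real) set" where
  "H2_mesh n x = {v \<in> L2 unit_ivl. \<forall>j\<in>{1..n}. v \<in> H2 (elem x j)}"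

type_synonym elem_trace = "real \<times> real \<times> real \<times> real"
type_synonym mesh_trace = "nat \<Rightarrow> elem_trace"

definition trace_elem :: "(nat \<Rightarrow> real) \<Rightarrow> nat \<Rightarrow> (real \<Rightarrow> real) \<Rightarrow> elem_trace" where
  "trace_elem x j z =
     (point_value (elem x j) z (x (j - 1)),
      point_value (elem x j) (wderiv 1 (elem x j) z) (x (j - 1)),
      point_value (elem x j) z (x j),
      point_value (elem x j) (wderiv 1 (elem x j) z) (x j))"

text \<open>The \<open>n\<close>-tuple of element traces, as an extensional function on \<open>{1..n}\<close>.\<close>

definition trace1 :: "nat \<Rightarrow> (nat \<Rightarrow> real) \<Rightarrow> (real \<Rightarrow> real) \<Rightarrow> mesh_trace" where
  "trace1 n x z = (\<lambda>j\<in>{1..n}. trace_elem x j z)"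

definition trace2 ::
  "nat \<Rightarrow> (nat \<Rightarrow> real) \<Rightarrow> (real \<Rightarrow> real) \<times> (real \<Rightarrow> real) \<Rightarrow> mesh_trace \<times> mesh_trace" where
  "trace2 n x = (\<lambda>(u, M). (trace1 n x u, trace1 n x M))"

definition trace_space ::
  "bc \<Rightarrow> real \<Rightarrow> nat \<Rightarrow> (nat \<Rightarrow> real) \<Rightarrow> (mesh_trace \<times> mesh_trace) set" where
  "trace_space a t n x = trace2 n x ` H2_bc a t"

definition bracket :: "(nat \<Rightarrow> real) \<Rightarrow> nat \<Rightarrow> (real \<Rightarrow> real) \<Rightarrow> (real \<Rightarrow> real) \<Rightarrow> real" where
  "bracket x j v w =
     point_value (elem x j) v (x j) * point_value (elem x j) w (x j)
     - point_value (elem x j) v (x (j - 1)) * point_value (elem x j) w (x (j - 1))"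

definition fun_pairing ::
  "real \<Rightarrow> nat \<Rightarrow> (nat \<Rightarrow> real) \<Rightarrow> (real \<Rightarrow> real) \<times> (real \<Rightarrow> real)
   \<Rightarrow> (real \<Rightarrow> real) \<times> (real \<Rightarrow> real) \<Rightarrow> real" where
  "fun_pairing t n x = (\<lambda>(u, M) (z, W). \<Sum>j = 1..n.
     (let d = wderiv 1 (elem x j) in
        - bracket x j u (d W) + bracket x j (d M) z
        - bracket x j M (\<lambda>s. d z s - t\<^sup>2 * d W s)
        + bracket x j (\<lambda>s. d u s - t\<^sup>2 * d M s) W))"

text \<open>
  The pairing with a trace \<open>q\<close> is computed from any pair of functions in \<open>H\<^sup>2(0,1)\<close> with trace \<open>q\<close>.
\<close>

definition trace_pairing ::
  "real \<Rightarrow> nat \<Rightarrow> (nat \<Rightarrow> real) \<Rightarrow> mesh_trace \<times> mesh_trace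
   \<Rightarrow> (real \<Rightarrow> real) \<times> (real \<Rightarrow> real) \<Rightarrow> real" where
  "trace_pairing t n x q zW =
     (THE c. \<exists>u\<in>H2 unit_ivl. \<exists>M\<in>H2 unit_ivl.
        trace2 n x (u, M) = q \<and> c = fun_pairing t n x (u, M) zW)"

definition mass_matrix :: "real \<Rightarrow> real^4^4" where
  "mass_matrix h = (h / 420) *\<^sub>R vector
     [vector [156, 54, 22 * h, - 13 * h],
      vector [54, 156, 13 * h, - 22 * h],
      vector [22 * h, 13 * h, 4 * h\<^sup>2, - 3 * h\<^sup>2],
      vector [- 13 * h, - 22 * h, - 3 * h\<^sup>2, 4 * h\<^sup>2]]"

definition stiffness_matrix :: "real \<Rightarrow> real^4^4" where
  "stiffness_matrix h = (2 / h ^ 3) *\<^sub>R vector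
     [vector [6, - 6, 3 * h, 3 * h],
      vector [- 6, 6, - 3 * h, - 3 * h],
      vector [3 * h, - 3 * h, 2 * h\<^sup>2, h\<^sup>2],
      vector [3 * h, - 3 * h, h\<^sup>2, 2 * h\<^sup>2]]"

text \<open>
  The coefficient vector lists first the two function values, then the two derivatives,
  so the order differs from that in \<^const>\<open>trace_elem\<close>.
\<close>

definition elem_trace_norm_sq :: "real \<Rightarrow> elem_trace \<Rightarrow> real" where
  "elem_trace_norm_sq h = (\<lambda>(v0, d0, v1, d1).
     let \<xi> = vector [v0, v1, d0, d1] :: real^4
     in \<xi> \<bullet> ((mass_matrix h + stiffness_matrix h) *v \<xi>))"

definition trace_norm_sq :: "nat \<Rightarrow> (nat \<Rightarrow> real) \<Rightarrow> mesh_trace \<times> mesh_trace \<Rightarrow> real" where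
  "trace_norm_sq n x = (\<lambda>(p, r). \<Sum>j = 1..n.
     elem_trace_norm_sq (x j - x (j - 1)) (p j) + elem_trace_norm_sq (x j - x (j - 1)) (r j))"

type_synonym trial = "(real \<Rightarrow> real) \<times> (real \<Rightarrow> real) \<times> mesh_trace \<times> mesh_trace"

definition trial_space :: "bc \<Rightarrow> real \<Rightarrow> nat \<Rightarrow> (nat \<Rightarrow> real) \<Rightarrow> trial set" where
  "trial_space a t n x = L2 unit_ivl \<times> L2 unit_ivl \<times> trace_space a t n x"

definition trial_norm :: "nat \<Rightarrow> (nat \<Rightarrow> real) \<Rightarrow> trial \<Rightarrow> real" where
  "trial_norm n x = (\<lambda>(u, M, q).
     sqrt ((l2_norm unit_ivl u)\<^sup>2 + (l2_norm unit_ivl M)\<^sup>2 + trace_norm_sq n x q))"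

definition test_space :: "nat \<Rightarrow> (nat \<Rightarrow> real) \<Rightarrow> ((real \<Rightarrow> real) \<times> (real \<Rightarrow> real)) set" where
  "test_space n x = H2_mesh n x \<times> H2_mesh n x"

definition load :: "(real \<Rightarrow> real) \<Rightarrow> (real \<Rightarrow> real) \<times> (real \<Rightarrow> real) \<Rightarrow> real" where
  "load f = (\<lambda>(z, W). - l2_inner unit_ivl f z)"

definition bform ::
  "real \<Rightarrow> nat \<Rightarrow> (nat \<Rightarrow> real) \<Rightarrow> trial \<Rightarrow> (real \<Rightarrow> real) \<times> (real \<Rightarrow> real) \<Rightarrow> real" where
  "bform t n x = (\<lambda>(u, M, q) (z, W).
     (\<Sum>j = 1..n. l2_inner (elem x j) u (wderiv 2 (elem x j) W))
     + (\<Sum>j = 1..n. l2_inner (elem x j) M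
          (\<lambda>s. W s + wderiv 2 (elem x j) z s - t\<^sup>2 * wderiv 2 (elem x j) W s))
     + trace_pairing t n x q (z, W))"

definition solves ::
  "bc \<Rightarrow> real \<Rightarrow> nat \<Rightarrow> (nat \<Rightarrow> real) \<Rightarrow> (real \<Rightarrow> real) \<Rightarrow> trial \<Rightarrow> bool" where
  "solves a t n x f U \<longleftrightarrow> U \<in> trial_space a t n x \<and>
     (\<forall>zW\<in>test_space n x. bform t n x U zW = load f zW)"

end

theory Submission
  imports Defs "HOL-Computational_Algebra.Polynomial"
begin

text \<open>
  Functions in \<open>H\<^sup>2\<close> of an interval are, up to null sets, twofold antiderivatives of \<open>L\<^sub>2\<close> functions
  (du Bois-Reymond), so Green's formula holds on every element and every statement about traces
  becomes one about point values. The boundary value problem \<open>W'' = F\<close>,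
  \<open>W + z'' - t\<^sup>2 W'' = G\<close> with \<open>(z, W)\<close> in the space of boundary condition \<open>a\<close> has an explicit solution
  bounded uniformly in \<open>t\<close>; for \<open>F = - f\<close>, \<open>G = 0\<close> it is the sought pair \<open>(u, M)\<close>.
  The problem is formally self-adjoint, and pairings of traces with conforming test functions vanish
  because the boundary terms telescope. Testing the difference of two solutions with the
  solution whose data \<open>F\<close>, \<open>G\<close> are that very difference shows that the \<open>L\<^sub>2\<close> parts are unique; testing with cubics
  supported on one element then shows that the traces are unique.
\<close>

subsection \<open>Smooth functions\<close>

text \<open>Stability of such a formulation usually means an inf-sup estimate, since u and M are
  merely in L_2 and the traces are separate unknowns. Here the load is only -(f,z), and for it the
  strong problem can be integrated by hand: the bound is read off the explicit pair, while
  uniqueness is a separate qualitative argument. It must go by duality, because an arbitrary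
  solution is not known to satisfy any differential equation; its regularity follows only after it
  is identified with the explicit one. Uniformity in t: y = z - t^2 W turns W + z'' - t^2 W'' = G
  into y'' = G - W, so t is left only in the boundary conditions. Uniformity in the mesh: the trace
  norm is that of the cubic Hermite interpolant, A being the Gram matrix of the Hermite basis and B
  that of its second derivatives. The B-part depends only on the mean and the first moment of v'' on
  the element, hence is bounded by the norm of v'' there. The A-part is at most 2 h_j S^2 if S
  bounds v and v' pointwise, and the lengths h_j add up to 1.\<close>

primrec times_differentiable :: "nat \<Rightarrow> (real \<Rightarrow> real) \<Rightarrow> bool" where
  "times_differentiable 0 f \<longleftrightarrow> True"
| "times_differentiable (Suc k) f \<longleftrightarrow>
     (\<exists>f'. (\<forall>x. (f has_real_derivative f' x) (at x)) \<and> times_differentiable k f')"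

definition smooth_fun :: "(real \<Rightarrow> real) \<Rightarrow> bool" where
  "smooth_fun f \<longleftrightarrow> (\<forall>k. times_differentiable k f)"

lemma times_differentiable_SucD: "times_differentiable (Suc k) f \<Longrightarrow> times_differentiable k f"
  by (induction k arbitrary: f) auto

lemma times_differentiable_add:
  "times_differentiable k f \<Longrightarrow> times_differentiable k g \<Longrightarrow> times_differentiable k (\<lambda>x. f x + g x)"
proof (induction k arbitrary: f g)
  case (Suc k)
  then obtain f' g' where
    "\<forall>x. (f has_real_derivative f' x) (at x)" "times_differentiable k f'"
    "\<forall>x. (g has_real_derivative g' x) (at x)" "times_differentiable k g'"
    by auto
  with Suc.IH[of f' g'] show ?case
    by (auto intro!: exI[of _ "\<lambda>x. f' x + g' x"] derivative_eq_intros)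
qed auto

lemma times_differentiable_mult:
  "times_differentiable k f \<Longrightarrow> times_differentiable k g \<Longrightarrow> times_differentiable k (\<lambda>x. f x * g x)"
proof (induction k arbitrary: f g)
  case (Suc k)
  then obtain f' g' where *:
    "\<forall>x. (f has_real_derivative f' x) (at x)" "times_differentiable k f'"
    "\<forall>x. (g has_real_derivative g' x) (at x)" "times_differentiable k g'"
    by auto
  have "times_differentiable k (\<lambda>x. f' x * g x + f x * g' x)"
    using *(2,4) Suc.prems[THEN times_differentiable_SucD]
    by (intro times_differentiable_add Suc.IH)
  moreover have "\<forall>x. ((\<lambda>x. f x * g x) has_real_derivative f' x * g x + f x * g' x) (at x)"
    using * by (auto intro!: derivative_eq_intros)
  ultimately show ?case by auto
qed auto

lemma times_differentiable_const: "times_differentiable k (\<lambda>x. c)"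
proof (induction k arbitrary: c)
  case (Suc k)
  have "\<forall>x. ((\<lambda>x. c) has_real_derivative 0) (at x)" by simp
  then show ?case unfolding times_differentiable.simps using Suc[of 0] by (intro exI[of _ "\<lambda>x. 0"] conjI)
qed simp

lemma times_differentiable_affine:
  "times_differentiable k f \<Longrightarrow> times_differentiable k (\<lambda>x. f (c * x + d))"
proof (induction k arbitrary: f)
  case (Suc k)
  then obtain f' where *:
    "\<forall>x. (f has_real_derivative f' x) (at x)" "times_differentiable k f'"
    by auto
  have "times_differentiable k (\<lambda>x. f' (c * x + d) * c)"
    by (rule times_differentiable_mult[OF Suc.IH[OF *(2)] times_differentiable_const])
  moreover have "\<forall>x. ((\<lambda>x. f (c * x + d)) has_real_derivative f' (c * x + d) * c) (at x)"
  proof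
    fix x
    have "((\<lambda>x. c * x + d) has_real_derivative c) (at x)"
      by (auto intro!: derivative_eq_intros)
    from DERIV_chain2[OF _ this] * show "((\<lambda>x. f (c * x + d)) has_real_derivative f' (c * x + d) * c) (at x)"
      by blast
  qed
  ultimately show ?case by auto
qed auto

lemma times_differentiable_deriv:
  assumes "times_differentiable (Suc k) f"
  shows "(f has_real_derivative deriv f x) (at x)" "times_differentiable k (deriv f)"
proof -
  obtain f' where *: "\<forall>x. (f has_real_derivative f' x) (at x)" "times_differentiable k f'"
    using assms by auto
  then have "deriv f = f'" by (auto intro!: ext DERIV_imp_deriv)
  with * show "(f has_real_derivative deriv f x) (at x)" "times_differentiable k (deriv f)" by auto
qed

text \<open>Bridge to \<open>test_fun\<close>, which iterates \<open>deriv\<close>. The inductive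
  predicate lets the derivative be any witness, so sums, products and affine substitutions go by
  induction without computing \<open>deriv ^^ k\<close>.\<close>

lemma times_differentiable_iff:
  "times_differentiable k f \<longleftrightarrow> (\<forall>i<k. (deriv ^^ i) f differentiable_on UNIV)"
proof (induction k arbitrary: f)
  case (Suc k)
  show ?case
  proof
    assume a: "times_differentiable (Suc k) f"
    note d = times_differentiable_deriv[OF a]
    show "\<forall>i<Suc k. (deriv ^^ i) f differentiable_on UNIV"
    proof (intro allI impI)
      fix i assume i: "i < Suc k"
      show "(deriv ^^ i) f differentiable_on UNIV"
      proof (cases i)
        case 0
        then show ?thesis
          using d(1) by (auto simp: differentiable_on_def real_differentiable_def)
      next
        case (Suc j)
        then show ?thesis
          using Suc.IH[of "deriv f"] d(2) i by (simp add: funpow_swap1)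
      qed
    qed
  next
    assume a: "\<forall>i<Suc k. (deriv ^^ i) f differentiable_on UNIV"
    then have "f differentiable_on UNIV" by (auto dest: spec[of _ 0])
    then have "\<forall>x. (f has_real_derivative deriv f x) (at x)"
      by (auto simp: differentiable_on_def DERIV_deriv_iff_real_differentiable)
    moreover have "times_differentiable k (deriv f)"
      unfolding Suc.IH
    proof (intro allI impI)
      fix i assume "i < k"
      then have "(deriv ^^ Suc i) f differentiable_on UNIV" using a by blast
      then show "(deriv ^^ i) (deriv f) differentiable_on UNIV" by (simp add: funpow_swap1)
    qed
    ultimately show "times_differentiable (Suc k) f" by auto
  qed
qed auto

lemma smooth_fun_iff: "smooth_fun f \<longleftrightarrow> (\<forall>k. (deriv ^^ k) f differentiable_on UNIV)"
  unfolding smooth_fun_def times_differentiable_iff by (metis lessI)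

lemma smooth_fun_deriv:
  assumes "smooth_fun f"
  shows "(f has_real_derivative deriv f x) (at x)" "smooth_fun (deriv f)"
  using assms times_differentiable_deriv unfolding smooth_fun_def by blast+

lemma smooth_funI_deriv:
  assumes "\<And>x. (f has_real_derivative f' x) (at x)" "smooth_fun f'"
  shows "smooth_fun f"
  unfolding smooth_fun_def
proof
  fix k show "times_differentiable k f"
    using assms by (cases k) (auto simp: smooth_fun_def)
qed

lemma smooth_fun_continuous: "smooth_fun f \<Longrightarrow> continuous_on S f"
  by (meson DERIV_isCont continuous_at_imp_continuous_on smooth_fun_deriv(1))

lemma smooth_fun_add: "smooth_fun f \<Longrightarrow> smooth_fun g \<Longrightarrow> smooth_fun (\<lambda>x. f x + g x)"
  and smooth_fun_mult: "smooth_fun f \<Longrightarrow> smooth_fun g \<Longrightarrow> smooth_fun (\<lambda>x. f x * g x)"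
  and smooth_fun_const: "smooth_fun (\<lambda>x. c)"
  and smooth_fun_affine: "smooth_fun f \<Longrightarrow> smooth_fun (\<lambda>x. f (c * x + d))"
  unfolding smooth_fun_def
  using times_differentiable_add times_differentiable_mult times_differentiable_const
    times_differentiable_affine by blast+

section \<open>The flat function exp(-1/x)\<close>

lemma poly_times_exp_neg_tendsto_0:
  "((\<lambda>y. y ^ k * poly p y / exp y) \<longlongrightarrow> 0) (at_top :: real filter)"
proof (induction p arbitrary: k)
  case 0
  then show ?case by simp
next
  case (pCons a p)
  have "((\<lambda>y::real. a * (y ^ k / exp y) + y ^ Suc k * poly p y / exp y) \<longlongrightarrow> a * 0 + 0) at_top"
    by (intro tendsto_intros tendsto_power_div_exp_0 pCons.IH)
  then show ?case
    by (simp add: algebra_simps add_divide_distrib)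
qed

text \<open>The polynomial factor makes the family closed under differentiation: with y = 1/x, the
  derivative replaces p by y^2 (p - p'). Smoothness is then one induction over all p at
  once.\<close>

definition exp_flat :: "real poly \<Rightarrow> real \<Rightarrow> real" where
  "exp_flat p x = (if x \<le> 0 then 0 else poly p (1 / x) * exp (- 1 / x))"

lemma exp_flat_has_derivative:
  "(exp_flat p has_real_derivative exp_flat (monom 1 2 * (p - pderiv p)) x) (at x)"
proof -
  consider "x < 0" | "x = 0" | "x > 0" by linarith
  then show ?thesis
  proof cases
    case 1
    have "((\<lambda>_. 0) has_real_derivative 0) (at x)" by simp
    then have "(exp_flat p has_real_derivative 0) (at x)"
      by (rule has_field_derivative_transform_within_open[of _ _ _ "{..<0}"])
        (use 1 in \<open>auto simp: exp_flat_def\<close>)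
    then show ?thesis using 1 by (simp add: exp_flat_def)
  next
    case 2
    \<comment> \<open>Under y = 1/h the difference quotient at 0 becomes y p(y) / exp y with y
      tending to infinity.\<close>
    have r: "((\<lambda>h. exp_flat p h / h) \<longlongrightarrow> 0) (at_right 0)"
    proof (rule Lim_transform_eventually)
      show "((\<lambda>h. inverse h ^ 1 * poly p (inverse h) / exp (inverse h)) \<longlongrightarrow> 0) (at_right 0)"
        by (rule filterlim_compose[OF poly_times_exp_neg_tendsto_0 filterlim_inverse_at_top_right])
      show "\<forall>\<^sub>F h in at_right 0. inverse h ^ 1 * poly p (inverse h) / exp (inverse h) = exp_flat p h / h"
        unfolding eventually_at_right_field
        by (intro exI[of _ 1]) (auto simp: exp_flat_def exp_minus field_simps)
    qed
    have l: "((\<lambda>h. exp_flat p h / h) \<longlongrightarrow> 0) (at_left 0)"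
    proof (rule Lim_transform_eventually)
      show "((\<lambda>h. 0) \<longlongrightarrow> 0) (at_left (0::real))" by simp
      show "\<forall>\<^sub>F h in at_left 0. 0 = exp_flat p h / h"
        unfolding eventually_at_left_field
        by (intro exI[of _ "-1"]) (auto simp: exp_flat_def)
    qed
    have "((\<lambda>h. exp_flat p h / h) \<longlongrightarrow> 0) (at 0)"
      using l r by (rule filterlim_split_at)
    then show ?thesis using 2 by (simp add: DERIV_def exp_flat_def)
  next
    case 3
    have "((\<lambda>x. poly p (1 / x) * exp (- 1 / x)) has_real_derivative
        poly (monom 1 2 * (p - pderiv p)) (1 / x) * exp (- 1 / x)) (at x)"
      using 3
      by (auto intro!: derivative_eq_intros poly_DERIV[THEN DERIV_chain2]
          simp: poly_monom field_simps power2_eq_square)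
    then have "(exp_flat p has_real_derivative
        poly (monom 1 2 * (p - pderiv p)) (1 / x) * exp (- 1 / x)) (at x)"
      by (rule has_field_derivative_transform_within_open[of _ _ _ "{0<..}"])
        (use 3 in \<open>auto simp: exp_flat_def\<close>)
    then show ?thesis using 3 by (simp add: exp_flat_def)
  qed
qed

lemma smooth_fun_exp_flat: "smooth_fun (exp_flat p)"
  unfolding smooth_fun_def
proof
  fix k show "times_differentiable k (exp_flat p)"
    by (induction k arbitrary: p) (auto intro!: exp_flat_has_derivative)
qed

subsection \<open>Test functions\<close>

lemma test_fun_iff:
  "\<phi> \<in> test_fun J \<longleftrightarrow> smooth_fun \<phi> \<and> (\<exists>K. compact K \<and> K \<subseteq> J \<and> (\<forall>x. x \<notin> K \<longrightarrow> \<phi> x = 0))"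
  by (auto simp: test_fun_def smooth_fun_iff)

lemma test_fun_Ioo_iff:
  assumes "a < b"
  shows "\<phi> \<in> test_fun {a<..<b} \<longleftrightarrow>
    smooth_fun \<phi> \<and> (\<exists>c d. a < c \<and> c < d \<and> d < b \<and> (\<forall>x. x \<notin> {c..d} \<longrightarrow> \<phi> x = 0))"
proof
  assume "\<phi> \<in> test_fun {a<..<b}"
  then obtain K where K: "smooth_fun \<phi>" "compact K" "K \<subseteq> {a<..<b}" "\<forall>x. x \<notin> K \<longrightarrow> \<phi> x = 0"
    by (auto simp: test_fun_iff)
  \<comment> \<open>The two interior points force c < d even when K is empty or a single
    point.\<close>
  define K' where "K' = insert ((2*a+b)/3) (insert ((a+2*b)/3) K)"
  have K': "compact K'" "K' \<noteq> {}" "K' \<subseteq> {a<..<b}"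
    using K assms by (auto simp: K'_def field_simps)
  obtain c where c: "c \<in> K'" "\<forall>x\<in>K'. c \<le> x" using compact_attains_inf[OF K'(1,2)] by auto
  obtain d where d: "d \<in> K'" "\<forall>x\<in>K'. x \<le> d" using compact_attains_sup[OF K'(1,2)] by auto
  have "c \<le> (2*a+b)/3" "(a+2*b)/3 \<le> d" using c d by (auto simp: K'_def)
  then have "c < d" using assms by simp
  moreover have "\<forall>x. x \<notin> {c..d} \<longrightarrow> \<phi> x = 0"
    using K c d by (auto simp: K'_def)
  ultimately show "smooth_fun \<phi> \<and> (\<exists>c d. a < c \<and> c < d \<and> d < b \<and> (\<forall>x. x \<notin> {c..d} \<longrightarrow> \<phi> x = 0))"
    using K(1) subsetD[OF K'(3) c(1)] subsetD[OF K'(3) d(1)] by fastforce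
next
  assume "smooth_fun \<phi> \<and> (\<exists>c d. a < c \<and> c < d \<and> d < b \<and> (\<forall>x. x \<notin> {c..d} \<longrightarrow> \<phi> x = 0))"
  then obtain c d where "smooth_fun \<phi>" "a < c" "d < b" "\<forall>x. x \<notin> {c..d} \<longrightarrow> \<phi> x = 0" by blast
  then show "\<phi> \<in> test_fun {a<..<b}"
    unfolding test_fun_iff by (intro conjI exI[of _ "{c..d}"]) auto
qed

text \<open>Supported in [c,d]; n is the steepness. Letting n grow while c, d move to the ends of an
  interval approximates its indicator by functions with values in [0,1].\<close>

definition bump :: "nat \<Rightarrow> real \<Rightarrow> real \<Rightarrow> real \<Rightarrow> real" where
  "bump n c d x = exp_flat 1 (real n * (x - c)) * exp_flat 1 (real n * (d - x))"

lemma bump_eq_0: "x \<notin> {c..d} \<Longrightarrow> bump n c d x = 0"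
  by (auto simp: bump_def exp_flat_def mult_nonneg_nonpos)

lemma exp_flat_1_bounds: "0 \<le> exp_flat 1 x" "exp_flat 1 x \<le> 1"
  by (auto simp: exp_flat_def)

lemma bump_bounds: "0 \<le> bump n c d x" "bump n c d x \<le> 1"
  by (auto simp: bump_def exp_flat_1_bounds intro!: mult_nonneg_nonneg mult_le_one)

lemma smooth_fun_bump: "smooth_fun (bump n c d)"
proof -
  have "smooth_fun (\<lambda>x. exp_flat 1 (real n * x + (- real n * c)) * exp_flat 1 ((- real n) * x + real n * d))"
    by (rule smooth_fun_mult[OF smooth_fun_affine[OF smooth_fun_exp_flat] smooth_fun_affine[OF smooth_fun_exp_flat]])
  moreover have "(\<lambda>x. exp_flat 1 (real n * x + (- real n * c)) * exp_flat 1 ((- real n) * x + real n * d)) = bump n c d"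
    by (auto simp: bump_def algebra_simps)
  ultimately show ?thesis by simp
qed

lemma bump_test_fun:
  assumes "a < c" "d < b"
  shows "bump n c d \<in> test_fun {a<..<b}"
  using assms unfolding test_fun_iff
  by (intro conjI smooth_fun_bump exI[of _ "{c..d}"]) (auto simp: bump_eq_0)

lemma test_fun_diff_scale:
  assumes "\<phi> \<in> test_fun J" "\<psi> \<in> test_fun J"
  shows "(\<lambda>x. \<phi> x - k * \<psi> x) \<in> test_fun J"
proof -
  obtain K L where "smooth_fun \<phi>" "smooth_fun \<psi>"
    and K: "compact K" "K \<subseteq> J" "\<forall>x. x \<notin> K \<longrightarrow> \<phi> x = 0"
    and L: "compact L" "L \<subseteq> J" "\<forall>x. x \<notin> L \<longrightarrow> \<psi> x = 0"
    using assms unfolding test_fun_iff by blast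
  then have "smooth_fun (\<lambda>x. \<phi> x + (-k) * \<psi> x)"
    by (intro smooth_fun_add[OF _ smooth_fun_mult[OF smooth_fun_const]])
  then show ?thesis
    unfolding test_fun_iff using K L by (intro conjI exI[of _ "K \<union> L"]) auto
qed

lemma test_fun_deriv:
  assumes "a < b" "\<phi> \<in> test_fun {a<..<b}"
  shows "deriv \<phi> \<in> test_fun {a<..<b}"
proof -
  obtain c d where *: "smooth_fun \<phi>" "a < c" "c < d" "d < b" "\<forall>x. x \<notin> {c..d} \<longrightarrow> \<phi> x = 0"
    using assms test_fun_Ioo_iff by blast
  have "deriv \<phi> x = 0" if x: "x \<notin> {c..d}" for x
  proof -
    have "(\<phi> has_real_derivative 0) (at x)"
      by (rule has_field_derivative_transform_within_open[of "\<lambda>_. 0" _ _ "- {c..d}"]) (use * x in auto)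
    then show ?thesis by (rule DERIV_imp_deriv)
  qed
  then show ?thesis using * smooth_fun_deriv(2) test_fun_Ioo_iff[OF assms(1)] by blast
qed

text \<open>Vanishing mean is exactly what makes the running integral return to 0 to the right of
  the support. This is the step of du Bois-Reymond that identifies the derivatives of test
  functions.\<close>

lemma test_fun_antideriv:
  assumes "a < b" "\<psi> \<in> test_fun {a<..<b}" "integral {a..b} \<psi> = 0"
  obtains \<phi> where "\<phi> \<in> test_fun {a<..<b}" "deriv \<phi> = \<psi>"
proof -
  obtain c d where *: "smooth_fun \<psi>" "a < c" "c < d" "d < b" "\<forall>x. x \<notin> {c..d} \<longrightarrow> \<psi> x = 0"
    using assms test_fun_Ioo_iff by blast
  define \<phi> where "\<phi> x = (if x \<le> a then 0 else integral {a..x} \<psi>)" for x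
  have cont: "continuous_on S \<psi>" for S using *(1) by (rule smooth_fun_continuous)
  have z1: "\<phi> x = 0" if "x < c" for x
  proof (cases "x \<le> a")
    case False
    have "integral {a..x} \<psi> = integral {a..x} (\<lambda>_. 0)"
      by (rule integral_cong) (use * that in auto)
    then show ?thesis by (simp add: \<phi>_def)
  qed (simp add: \<phi>_def)
  have z2: "\<phi> x = 0" if "d < x" for x
  proof -
    have tail: "integral {y..z} \<psi> = 0" if "d < y" for y z
    proof -
      have "integral {y..z} \<psi> = integral {y..z} (\<lambda>_. 0)"
        by (rule integral_cong) (use * that in auto)
      then show ?thesis by simp
    qed
    have "integral {a..x} \<psi> = 0"
    proof (cases "x \<le> b")
      case True
      have "integral {a..x} \<psi> + integral {x..b} \<psi> = integral {a..b} \<psi>"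
        by (rule Henstock_Kurzweil_Integration.integral_combine)
          (use * that True cont in \<open>auto intro!: integrable_continuous_real\<close>)
      then show ?thesis using tail[OF that] assms(3) by simp
    next
      case False
      have "integral {a..b} \<psi> + integral {b..x} \<psi> = integral {a..x} \<psi>"
        by (rule Henstock_Kurzweil_Integration.integral_combine)
          (use * that False cont in \<open>auto intro!: integrable_continuous_real\<close>)
      then show ?thesis using tail[OF *(4)] assms(3) by simp
    qed
    then show ?thesis using * that by (simp add: \<phi>_def)
  qed
  have der: "(\<phi> has_real_derivative \<psi> x) (at x)" for x
  proof (cases "x < c")
    case True
    have "(\<phi> has_real_derivative 0) (at x)"
      by (rule has_field_derivative_transform_within_open[of "\<lambda>_. 0" _ _ "{..<c}"]) (use z1 True in auto)
    then show ?thesis using * True by simp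
  next
    case False
    have "((\<lambda>u. integral {a..u} \<psi>) has_real_derivative \<psi> x) (at x within {a..x+1})"
      by (rule integral_has_real_derivative) (use cont * False in auto)
    then have "((\<lambda>u. integral {a..u} \<psi>) has_real_derivative \<psi> x) (at x)"
      by (metis False *(2) at_within_Icc_at less_add_one linorder_not_less order_less_le_trans)
    then show ?thesis
      by (rule has_field_derivative_transform_within_open[of _ _ _ "{a<..}"])
        (use * False in \<open>auto simp: \<phi>_def\<close>)
  qed
  have "smooth_fun \<phi>" using der *(1) by (rule smooth_funI_deriv)
  then have "\<phi> \<in> test_fun {a<..<b}"
    unfolding test_fun_Ioo_iff[OF assms(1)] using * z1 z2 by (intro conjI exI[of _ c] exI[of _ d]) auto
  moreover have "deriv \<phi> = \<psi>" using der by (auto intro!: ext DERIV_imp_deriv)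
  ultimately show ?thesis using that by blast
qed

subsection \<open>Square-integrable functions\<close>

lemma L2_measurable: "f \<in> L2 J \<Longrightarrow> f \<in> borel_measurable (lebesgue_on J)"
  by (simp add: L2_def)

lemma L2_integrable_mult:
  assumes "f \<in> L2 J" "g \<in> L2 J"
  shows "integrable (lebesgue_on J) (\<lambda>x. f x * g x)"
proof (rule Bochner_Integration.integrable_bound[of _ "\<lambda>x. (f x)\<^sup>2 + (g x)\<^sup>2"])
  show "integrable (lebesgue_on J) (\<lambda>x. (f x)\<^sup>2 + (g x)\<^sup>2)"
    using assms by (simp add: L2_def)
  show "(\<lambda>x. f x * g x) \<in> borel_measurable (lebesgue_on J)"
    using assms by (simp add: L2_def borel_measurable_times)
  have "\<bar>a * b\<bar> \<le> a\<^sup>2 + b\<^sup>2" for a b :: real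
    using sum_squares_bound[of "\<bar>a\<bar>" "\<bar>b\<bar>"] mult_nonneg_nonneg[of "\<bar>a\<bar>" "\<bar>b\<bar>"]
    unfolding abs_mult mult.assoc power2_abs by linarith
  then show "AE x in lebesgue_on J. norm (f x * g x) \<le> norm ((f x)\<^sup>2 + (g x)\<^sup>2)"
    by (simp add: abs_of_nonneg)
qed

lemma L2_add: "f \<in> L2 J \<Longrightarrow> g \<in> L2 J \<Longrightarrow> (\<lambda>x. f x + g x) \<in> L2 J"
  using L2_integrable_mult[of f J g]
  by (auto simp: L2_def power2_sum mult.assoc intro!: borel_measurable_add)

lemma L2_cmult: "f \<in> L2 J \<Longrightarrow> (\<lambda>x. c * f x) \<in> L2 J"
  by (auto simp: L2_def power_mult_distrib intro!: borel_measurable_times)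

lemma L2_diff: "f \<in> L2 J \<Longrightarrow> g \<in> L2 J \<Longrightarrow> (\<lambda>x. f x - g x) \<in> L2 J"
  using L2_add[of f J "\<lambda>x. (- 1) * g x"] L2_cmult[of g J "-1"] by simp

lemma L2_uminus: "f \<in> L2 J \<Longrightarrow> (\<lambda>x. - f x) \<in> L2 J"
  using L2_cmult[of f J "-1"] by simp

lemma L2_continuous:
  assumes "continuous_on {a..b} f"
  shows "f \<in> L2 {a<..<b}"
proof -
  have "f absolutely_integrable_on {a..b}" "(\<lambda>x. (f x)\<^sup>2) absolutely_integrable_on {a..b}"
    using assms by (auto intro!: absolutely_integrable_continuous_real continuous_intros)
  then have "f absolutely_integrable_on {a<..<b}" "(\<lambda>x. (f x)\<^sup>2) absolutely_integrable_on {a<..<b}"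
    by (simp_all add: absolutely_integrable_on_Icc_iff_Ioo)
  then have "integrable (lebesgue_on {a<..<b}) f" "integrable (lebesgue_on {a<..<b}) (\<lambda>x. (f x)\<^sup>2)"
    by (simp_all add: absolutely_integrable_imp_integrable)
  then show ?thesis by (simp add: L2_def)
qed

lemma L2_absolutely_integrable:
  assumes "f \<in> L2 {a<..<b}"
  shows "f absolutely_integrable_on {a..b}"
proof -
  have "(\<lambda>x. 1) \<in> L2 {a<..<b}" by (intro L2_continuous continuous_intros)
  from L2_integrable_mult[OF assms this] have "integrable (lebesgue_on {a<..<b}) f" by simp
  then have "f absolutely_integrable_on {a<..<b}"
    by (simp add: set_integrable_def integrable_restrict_space)
  then show ?thesis by (simp add: absolutely_integrable_on_Icc_iff_Ioo)
qed

lemma L2_integrable: "f \<in> L2 {a<..<b} \<Longrightarrow> f integrable_on {a..b}"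
  by (meson L2_absolutely_integrable set_lebesgue_integral_eq_integral(1))

lemma L2_subset:
  assumes "f \<in> L2 J" "I \<subseteq> J" "I \<in> sets lebesgue" "J \<in> sets lebesgue"
  shows "f \<in> L2 I"
proof -
  have "set_integrable lebesgue J (\<lambda>x. (f x)\<^sup>2)"
    using assms(1,4) by (simp add: L2_def set_integrable_def integrable_restrict_space)
  then have "set_integrable lebesgue I (\<lambda>x. (f x)\<^sup>2)"
    using set_integrable_subset assms(2,3) by blast
  then show ?thesis
    using assms measurable_restrict_mono[OF _ assms(2)]
    by (auto simp add: L2_def set_integrable_def integrable_restrict_space)
qed

section \<open>Equality almost everywhere\<close>

lemma ae_eq_refl [simp]: "ae_eq J f f"
  by (simp add: ae_eq_def)

lemma ae_eq_sym: "ae_eq J f g \<Longrightarrow> ae_eq J g f"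
  by (auto simp: ae_eq_def)

lemma ae_eq_trans:
  assumes "ae_eq J f g" "ae_eq J g h"
  shows "ae_eq J f h"
  using assms unfolding ae_eq_def by eventually_elim simp

lemma ae_eq_diff:
  assumes "ae_eq J f g" "ae_eq J f' g'"
  shows "ae_eq J (\<lambda>x. f x - f' x) (\<lambda>x. g x - g' x)"
  using assms unfolding ae_eq_def by eventually_elim simp

lemma ae_eq_add:
  assumes "ae_eq J f g" "ae_eq J f' g'"
  shows "ae_eq J (\<lambda>x. f x + f' x) (\<lambda>x. g x + g' x)"
  using assms unfolding ae_eq_def by eventually_elim simp

lemma ae_eq_cmult:
  assumes "ae_eq J f g"
  shows "ae_eq J (\<lambda>x. c * f x) (\<lambda>x. c * g x)"
  using assms unfolding ae_eq_def by eventually_elim simp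

lemma ae_eq_subset:
  assumes "ae_eq J f g" "I \<subseteq> J" "I \<in> sets lebesgue" "J \<in> sets lebesgue"
  shows "ae_eq I f g"
  using assms by (auto simp: ae_eq_def AE_restrict_space_iff)

text \<open>Completeness of Lebesgue measure: preimages under f and g differ by a subset of a null
  set. Hence a representative may be exchanged for any function equal to it almost
  everywhere.\<close>

lemma measurable_ae_eq:
  assumes "f \<in> borel_measurable (lebesgue_on J)" "ae_eq J f g" "J \<in> sets lebesgue"
  shows "g \<in> borel_measurable (lebesgue_on J)"
proof -
  have J': "J \<inter> space lebesgue \<in> sets lebesgue" using assms(3) by simp
  show ?thesis
  proof (rule measurableI)
    fix A :: "real set" assume A: "A \<in> sets borel"
    have f: "{x \<in> J. f x \<in> A} \<in> sets lebesgue"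
      using measurable_sets[OF assms(1) A] sets_restrict_space_iff[OF J', of "f -` A \<inter> J"]
      by (simp add: vimage_def Int_def conj_commute)
    have "{x \<in> J. g x \<in> A} \<in> sets lebesgue"
    proof (rule complete_measure.in_sets_AE[OF _ _ f])
      show "complete_measure (lebesgue :: real measure)" by (rule completion.complete_measure_axioms)
      show "AE x in lebesgue. (x \<in> {x \<in> J. f x \<in> A}) = (x \<in> {x \<in> J. g x \<in> A})"
        using assms(2,3) by (auto simp: ae_eq_def AE_restrict_space_iff)
    qed auto
    then show "g -` A \<inter> space (lebesgue_on J) \<in> sets (lebesgue_on J)"
      using sets_restrict_space_iff[OF J', of "g -` A \<inter> J"] by (simp add: vimage_def Int_def conj_commute)
  qed auto
qed

lemma L2_ae_eq:
  assumes "f \<in> L2 J" "ae_eq J f g" "J \<in> sets lebesgue"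
  shows "g \<in> L2 J"
proof -
  have g: "g \<in> borel_measurable (lebesgue_on J)"
    using assms measurable_ae_eq L2_measurable by blast
  have "AE x in lebesgue_on J. (f x)\<^sup>2 = (g x)\<^sup>2"
    using assms(2) unfolding ae_eq_def by eventually_elim simp
  then have "integrable (lebesgue_on J) (\<lambda>x. (g x)\<^sup>2)"
    using assms(1) g by (subst integrable_cong_AE[of _ _ "\<lambda>x. (f x)\<^sup>2"]) (auto simp: L2_def)
  with g show ?thesis by (simp add: L2_def)
qed

lemma l2_inner_cong:
  assumes "ae_eq J f f'" "ae_eq J g g'" "f \<in> L2 J" "g \<in> L2 J" "J \<in> sets lebesgue"
  shows "l2_inner J f g = l2_inner J f' g'"
  unfolding l2_inner_def
proof (rule integral_cong_AE)
  show "AE x in lebesgue_on J. f x * g x = f' x * g' x"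
    using assms(1,2) unfolding ae_eq_def by eventually_elim simp
  show "(\<lambda>x. f x * g x) \<in> borel_measurable (lebesgue_on J)" "(\<lambda>x. f' x * g' x) \<in> borel_measurable (lebesgue_on J)"
    by (intro borel_measurable_times L2_measurable[OF assms(3)] L2_measurable[OF assms(4)]
        measurable_ae_eq[OF L2_measurable[OF assms(3)] assms(1,5)]
        measurable_ae_eq[OF L2_measurable[OF assms(4)] assms(2,5)])+
qed

section \<open>The inner product and the norm\<close>

lemma l2_inner_commute: "l2_inner J f g = l2_inner J g f"
  by (simp add: l2_inner_def mult.commute)

lemma l2_inner_add_left:
  "f \<in> L2 J \<Longrightarrow> g \<in> L2 J \<Longrightarrow> h \<in> L2 J \<Longrightarrow> l2_inner J (\<lambda>x. f x + g x) h = l2_inner J f h + l2_inner J g h"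
  unfolding l2_inner_def by (simp add: distrib_right L2_integrable_mult)

lemma l2_inner_add_right:
  "f \<in> L2 J \<Longrightarrow> g \<in> L2 J \<Longrightarrow> h \<in> L2 J \<Longrightarrow> l2_inner J h (\<lambda>x. f x + g x) = l2_inner J h f + l2_inner J h g"
  unfolding l2_inner_def by (simp add: distrib_left L2_integrable_mult)

lemma l2_inner_diff_left:
  "f \<in> L2 J \<Longrightarrow> g \<in> L2 J \<Longrightarrow> h \<in> L2 J \<Longrightarrow> l2_inner J (\<lambda>x. f x - g x) h = l2_inner J f h - l2_inner J g h"
  unfolding l2_inner_def by (simp add: left_diff_distrib L2_integrable_mult)

lemma l2_inner_diff_right:
  "f \<in> L2 J \<Longrightarrow> g \<in> L2 J \<Longrightarrow> h \<in> L2 J \<Longrightarrow> l2_inner J h (\<lambda>x. f x - g x) = l2_inner J h f - l2_inner J h g"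
  unfolding l2_inner_def by (simp add: right_diff_distrib L2_integrable_mult)

lemma l2_inner_cmult_left: "l2_inner J (\<lambda>x. c * f x) g = c * l2_inner J f g"
  and l2_inner_cmult_right: "l2_inner J f (\<lambda>x. c * g x) = c * l2_inner J f g"
  unfolding l2_inner_def by (simp_all add: mult.assoc mult.left_commute)

lemma l2_inner_uminus_left: "l2_inner J (\<lambda>x. - f x) g = - l2_inner J f g"
  by (simp add: l2_inner_def)

lemma l2_inner_nonneg: "0 \<le> l2_inner J f f"
  unfolding l2_inner_def by (intro integral_nonneg_AE) simp

lemma l2_norm_sq: "(l2_norm J f)\<^sup>2 = l2_inner J f f"
  by (simp add: l2_norm_def l2_inner_nonneg)

lemma l2_norm_nonneg: "0 \<le> l2_norm J f"
  by (simp add: l2_norm_def l2_inner_nonneg)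

lemma l2_inner_self_eq_0:
  assumes "f \<in> L2 J" "l2_inner J f f = 0"
  shows "ae_eq J f (\<lambda>x. 0)"
proof -
  have "AE x in lebesgue_on J. f x * f x = 0"
    using assms L2_integrable_mult[OF assms(1,1)] unfolding l2_inner_def
    by (subst (asm) integral_nonneg_eq_0_iff_AE) auto
  then show ?thesis by (simp add: ae_eq_def)
qed

lemma l2_Cauchy_Schwarz:
  assumes f: "f \<in> L2 J" and g: "g \<in> L2 J"
  shows "(l2_inner J f g)\<^sup>2 \<le> l2_inner J f f * l2_inner J g g"
proof -
  have q: "0 \<le> l2_inner J g g * s\<^sup>2 - 2 * s * l2_inner J f g + l2_inner J f f" for s
  proof -
    have "0 \<le> l2_inner J (\<lambda>x. f x - s * g x) (\<lambda>x. f x - s * g x)" by (rule l2_inner_nonneg)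
    also have "\<dots> = l2_inner J f f - 2 * s * l2_inner J f g + s\<^sup>2 * l2_inner J g g"
      using f g
      by (simp add: l2_inner_diff_left l2_inner_diff_right L2_cmult L2_diff l2_inner_cmult_left
          l2_inner_cmult_right l2_inner_commute[of J g f] algebra_simps power2_eq_square)
    finally show ?thesis by (simp add: algebra_simps)
  qed
  show ?thesis
  proof (cases "l2_inner J g g = 0")
    case True
    have "l2_inner J f g = 0"
    proof (rule ccontr)
      assume "l2_inner J f g \<noteq> 0"
      \<comment> \<open>With (g,g) = 0 the quadratic is affine in s, and this s gives it the value
        -1.\<close>
      then show False
        using q[of "(l2_inner J f f + 1) / (2 * l2_inner J f g)"] True by (simp add: field_simps)
    qed
    then show ?thesis using True by simp
  next
    case False
    then have "l2_inner J g g > 0" using l2_inner_nonneg[of J g] by linarith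
    then show ?thesis
      using q[of "l2_inner J f g / l2_inner J g g"]
      by (simp add: field_simps power2_eq_square)
  qed
qed

lemma l2_inner_Ioo:
  assumes "f \<in> L2 {a<..<b}" "g \<in> L2 {a<..<b}"
  shows "l2_inner {a<..<b} f g = integral {a..b} (\<lambda>x. f x * g x)"
    and "(\<lambda>x. f x * g x) integrable_on {a..b}"
proof -
  note * = L2_integrable_mult[OF assms]
  have "((\<lambda>x. f x * g x) has_integral l2_inner {a<..<b} f g) {a<..<b}"
    unfolding l2_inner_def by (rule has_integral_integral_lebesgue_on[OF *]) simp
  then have "((\<lambda>x. f x * g x) has_integral l2_inner {a<..<b} f g) {a..b}"
    using has_integral_Icc_iff_Ioo by blast
  then show "l2_inner {a<..<b} f g = integral {a..b} (\<lambda>x. f x * g x)"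
    "(\<lambda>x. f x * g x) integrable_on {a..b}"
    by (auto simp: integral_unique has_integral_integrable)
qed

subsection \<open>Antiderivatives of square-integrable functions\<close>

text \<open>Membership of v in the Sobolev space W^{1,2}(a,b), with weak derivative g and v its
  continuous representative. The integral form avoids differentiability almost everywhere and makes
  endpoint values literal function values.\<close>

definition antideriv :: "real \<Rightarrow> real \<Rightarrow> (real \<Rightarrow> real) \<Rightarrow> (real \<Rightarrow> real) \<Rightarrow> bool" where
  "antideriv a b v g \<longleftrightarrow> g \<in> L2 {a<..<b} \<and> (\<forall>x\<in>{a..b}. v x = v a + integral {a..x} g)"

lemma antiderivI: "g \<in> L2 {a<..<b} \<Longrightarrow> antideriv a b (\<lambda>x. c + integral {a..x} g) g"
  by (simp add: antideriv_def)

lemma antideriv_L2: "antideriv a b v g \<Longrightarrow> g \<in> L2 {a<..<b}"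
  by (simp add: antideriv_def)

lemma antideriv_eq: "antideriv a b v g \<Longrightarrow> x \<in> {a..b} \<Longrightarrow> v x = v a + integral {a..x} g"
  unfolding antideriv_def by blast

lemma antideriv_integral:
  assumes "antideriv a b v g" "x \<in> {a..b}"
  shows "integral {a..x} g = v x - v a"
  using antideriv_eq[OF assms] by linarith

lemma antideriv_continuous:
  assumes "antideriv a b v g"
  shows "continuous_on {a..b} v"
proof -
  have "continuous_on {a..b} (\<lambda>x. v a + integral {a..x} g)"
    using L2_integrable[OF antideriv_L2[OF assms]]
    by (intro continuous_intros indefinite_integral_continuous_1)
  then show ?thesis
    by (rule continuous_on_eq) (rule antideriv_eq[OF assms, symmetric])
qed

lemma antideriv_L2_fun: "antideriv a b v g \<Longrightarrow> v \<in> L2 {a<..<b}"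
  by (intro L2_continuous antideriv_continuous)

lemma antideriv_subinterval:
  assumes v: "antideriv a b v g" and cd: "a \<le> c" "c \<le> d" "d \<le> b"
  shows "antideriv c d v g"
  unfolding antideriv_def
proof (intro conjI ballI)
  show "g \<in> L2 {c<..<d}"
    using antideriv_L2[OF v] cd by (auto intro: L2_subset)
  fix x assume x: "x \<in> {c..d}"
  have "integral {a..c} g + integral {c..x} g = integral {a..x} g"
    by (rule Henstock_Kurzweil_Integration.integral_combine)
      (use cd x integrable_on_subinterval[OF L2_integrable[OF antideriv_L2[OF v]]] in auto)
  then show "v x = v c + integral {c..x} g"
    using antideriv_eq[OF v, of x] antideriv_eq[OF v, of c] cd x by simp
qed

lemma antideriv_add:
  assumes "antideriv a b v g" "antideriv a b w h"
  shows "antideriv a b (\<lambda>x. v x + w x) (\<lambda>x. g x + h x)"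
  unfolding antideriv_def
proof (intro conjI ballI)
  show "(\<lambda>x. g x + h x) \<in> L2 {a<..<b}" using assms antideriv_L2 L2_add by blast
  fix x assume x: "x \<in> {a..b}"
  have "integral {a..x} (\<lambda>x. g x + h x) = integral {a..x} g + integral {a..x} h"
    using assms[THEN antideriv_L2] x
    by (intro Henstock_Kurzweil_Integration.integral_add integrable_on_subinterval[OF L2_integrable]) auto
  then show "v x + w x = v a + w a + integral {a..x} (\<lambda>x. g x + h x)"
    using antideriv_eq[OF assms(1) x] antideriv_eq[OF assms(2) x] by simp
qed

lemma antideriv_cmult:
  assumes "antideriv a b v g"
  shows "antideriv a b (\<lambda>x. c * v x) (\<lambda>x. c * g x)"
  unfolding antideriv_def
proof (intro conjI ballI)
  show "(\<lambda>x. c * g x) \<in> L2 {a<..<b}" using assms antideriv_L2 L2_cmult by blast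
  fix x assume x: "x \<in> {a..b}"
  show "c * v x = c * v a + integral {a..x} (\<lambda>x. c * g x)"
    using antideriv_eq[OF assms(1) x] by (simp add: distrib_left)
qed

lemma antideriv_diff:
  assumes "antideriv a b v g" "antideriv a b w h"
  shows "antideriv a b (\<lambda>x. v x - w x) (\<lambda>x. g x - h x)"
  using antideriv_add[OF assms(1) antideriv_cmult[OF assms(2), of "-1"]] by simp

lemma antideriv_DERIV:
  assumes "\<And>x. (v has_real_derivative g x) (at x)" "continuous_on {a..b} g"
  shows "antideriv a b v g"
  unfolding antideriv_def
proof (intro conjI ballI)
  show "g \<in> L2 {a<..<b}" using assms(2) by (rule L2_continuous)
  fix x assume x: "x \<in> {a..b}"
  have "(g has_integral (v x - v a)) {a..x}"
    by (rule fundamental_theorem_of_calculus)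
      (use x assms(1) in \<open>auto simp: has_real_derivative_iff_has_vector_derivative[symmetric]
        intro: has_field_derivative_at_within\<close>)
  then show "v x = v a + integral {a..x} g" by (simp add: integral_unique)
qed

section \<open>Integration by parts\<close>

lemma L2_integrable_Ioo:
  assumes "g \<in> L2 {a<..<b}"
  shows "integrable (lebesgue_on {a<..<b}) g"
proof -
  have "(\<lambda>x. 1) \<in> L2 {a<..<b}" by (intro L2_continuous continuous_intros)
  from L2_integrable_mult[OF assms this] show ?thesis by simp
qed

text \<open>The inner integrals over the two triangles of a square. One triangle contains the
  diagonal and the other does not, hence both truncations; they differ in a single point.\<close>

lemma integral_upto_eq:
  assumes g: "g \<in> L2 {a<..<b}" and x: "x \<in> {a<..<b}"
  shows "(LINT y|lebesgue_on {a<..<b}. (if y \<le> x then g y else 0)) = integral {a..x} g"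
    and "(LINT y|lebesgue_on {a<..<b}. (if y < x then g y else 0)) = integral {a..x} g"
proof -
  have i: "integrable (lebesgue_on {a<..<b}) g"
    using g by (rule L2_integrable_Ioo)
  have m: "{y \<in> {a<..<b}. P y} \<in> sets (lebesgue_on {a<..<b})" if "{y. P y} \<in> sets borel" for P
    using that by (auto simp: sets_restrict_space image_iff Int_def intro!: bexI[of _ "{y. P y}"])
  have eq: "(LINT y|lebesgue_on {a<..<b}. (if P y then g y else 0)) = integral {a..x} g"
    if P: "{y. P y} \<in> sets borel" and Px: "\<And>y. y \<noteq> x \<Longrightarrow> P y \<longleftrightarrow> y \<le> x" for P
  proof -
    have "integrable (lebesgue_on {a<..<b}) (\<lambda>y. indicator {y \<in> {a<..<b}. P y} y *\<^sub>R g y)"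
      by (rule integrable_mult_indicator[OF m[OF P] i])
    then have "integrable (lebesgue_on {a<..<b}) (\<lambda>y. (if P y then g y else 0))"
      by (rule Bochner_Integration.integrable_cong[THEN iffD1, rotated 2]) (auto simp: indicator_def)
    then have "((\<lambda>y. (if P y then g y else 0)) has_integral
        (LINT y|lebesgue_on {a<..<b}. (if P y then g y else 0))) {a<..<b}"
      by (rule has_integral_integral_lebesgue_on) simp
    then have "((\<lambda>y. (if P y then g y else 0)) has_integral
        (LINT y|lebesgue_on {a<..<b}. (if P y then g y else 0))) {a..b}"
      by (simp add: has_integral_Icc_iff_Ioo)
    then have "((\<lambda>y. if y \<in> {a..x} then g y else 0) has_integral
        (LINT y|lebesgue_on {a<..<b}. (if P y then g y else 0))) {a..b}"
      by (rule has_integral_spike_finite[of "{x}", rotated 2]) (auto simp: Px)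
    then have "(g has_integral (LINT y|lebesgue_on {a<..<b}. (if P y then g y else 0))) {a..x}"
      using has_integral_restrict[of "{a..x}" "{a..b}" g] x by auto
    then show ?thesis by (simp add: integral_unique)
  qed
  show "(LINT y|lebesgue_on {a<..<b}. (if y \<le> x then g y else 0)) = integral {a..x} g"
    by (rule eq) (auto simp flip: atMost_def)
  show "(LINT y|lebesgue_on {a<..<b}. (if y < x then g y else 0)) = integral {a..x} g"
    by (rule eq) (auto simp flip: lessThan_def)
qed

lemma LINT_eq_integral:
  assumes "g \<in> L2 {a<..<b}"
  shows "integral\<^sup>L (lebesgue_on {a<..<b}) g = integral {a..b} g"
  using has_integral_integral_lebesgue_on[OF L2_integrable_Ioo[OF assms]]
  by (simp add: has_integral_Icc_iff_Ioo[symmetric] integral_unique)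

text \<open>The right-hand side is the integral of \<open>h x * g y\<close> over a square; splitting the square along its
  diagonal gives the two terms on the left.\<close>

lemma integral_by_parts_zero:
  assumes g: "g \<in> L2 {a<..<b}" and h: "h \<in> L2 {a<..<b}"
  shows "(LINT x|lebesgue_on {a<..<b}. h x * integral {a..x} g)
       + (LINT x|lebesgue_on {a<..<b}. g x * integral {a..x} h) = integral {a..b} g * integral {a..b} h"
proof -
  define M where "M = lebesgue_on {a<..<b}"
  have "finite_measure M"
    unfolding M_def by (rule finite_measure_lebesgue_on) (metis box_real(1) lmeasurable_box)
  then interpret M: finite_measure M .
  interpret P: pair_sigma_finite M M ..
  have id: "(\<lambda>x. x) \<in> borel_measurable M"
    unfolding M_def by (intro measurable_restrict_space1 measurable_completion) simp
  have [measurable]: "g \<in> borel_measurable M" "h \<in> borel_measurable M"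
    using g h by (simp_all add: M_def L2_measurable)
  note [measurable] = id
  have ig: "integrable M g" "integrable M h"
    using g h by (simp_all add: M_def L2_integrable_Ioo)
  have le [measurable]: "Measurable.pred (M \<Otimes>\<^sub>M M) (\<lambda>p. snd p \<le> fst p)"
  proof -
    have "(\<lambda>p. fst p) \<in> borel_measurable (M \<Otimes>\<^sub>M M)" "(\<lambda>p. snd p) \<in> borel_measurable (M \<Otimes>\<^sub>M M)"
      using measurable_compose[OF measurable_fst id] measurable_compose[OF measurable_snd id] by auto
    then show ?thesis unfolding pred_def by (intro borel_measurable_le)
  qed
  \<comment> \<open>This product dominates both triangular integrands, so Fubini applies to
    each.\<close>
  have prod: "integrable (M \<Otimes>\<^sub>M M) (\<lambda>p. h (fst p) * g (snd p))"
  proof (rule P.Fubini_integrable)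
    show "(\<lambda>p. h (fst p) * g (snd p)) \<in> borel_measurable (M \<Otimes>\<^sub>M M)" by measurable
    show "integrable M (\<lambda>x. LINT y|M. norm (h (fst (x, y)) * g (snd (x, y))))"
      using ig by (simp add: abs_mult)
    show "AE x in M. integrable M (\<lambda>y. h (fst (x, y)) * g (snd (x, y)))"
      using ig by simp
  qed
  have tri1: "integrable (M \<Otimes>\<^sub>M M) (\<lambda>(x, y). h x * (if y \<le> x then g y else 0))"
    by (rule Bochner_Integration.integrable_bound[OF prod]) (auto simp: split_beta)
  have tri2: "integrable (M \<Otimes>\<^sub>M M) (\<lambda>(x, y). (if x < y then h x else 0) * g y)"
  proof (rule Bochner_Integration.integrable_bound[OF prod])
    have "(\<lambda>p. if \<not> snd p \<le> fst p then h (fst p) * g (snd p) else 0) \<in> borel_measurable (M \<Otimes>\<^sub>M M)"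
      by measurable
    then show "(\<lambda>(x, y). (if x < y then h x else 0) * g y) \<in> borel_measurable (M \<Otimes>\<^sub>M M)"
      by (rule measurable_cong[THEN iffD1, rotated]) (auto simp: split_beta)
  qed (auto simp: split_beta)
  have "integral {a..b} g * integral {a..b} h = integral\<^sup>L M h * integral\<^sup>L M g"
    using g h by (simp add: M_def LINT_eq_integral)
  also have "\<dots> = (LINT x|M. LINT y|M. h x * g y)"
    by simp
  also have "\<dots> = integral\<^sup>L (M \<Otimes>\<^sub>M M) (\<lambda>p. h (fst p) * g (snd p))"
    using P.integral_fst[of "\<lambda>x y. h x * g y"] prod by (simp add: case_prod_beta')
  also have "\<dots> = integral\<^sup>L (M \<Otimes>\<^sub>M M) (\<lambda>p. (case p of (x, y) \<Rightarrow> h x * (if y \<le> x then g y else 0))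
        + (case p of (x, y) \<Rightarrow> (if x < y then h x else 0) * g y))"
    by (intro Bochner_Integration.integral_cong) auto
  also have "\<dots> = integral\<^sup>L (M \<Otimes>\<^sub>M M) (\<lambda>(x, y). h x * (if y \<le> x then g y else 0))
      + integral\<^sup>L (M \<Otimes>\<^sub>M M) (\<lambda>(x, y). (if x < y then h x else 0) * g y)"
    by (rule Bochner_Integration.integral_add[OF tri1 tri2])
  also have "integral\<^sup>L (M \<Otimes>\<^sub>M M) (\<lambda>(x, y). h x * (if y \<le> x then g y else 0))
      = (LINT x|M. LINT y|M. h x * (if y \<le> x then g y else 0))"
    using P.integral_fst[OF tri1] by simp
  also have "\<dots> = (LINT x|M. h x * integral {a..x} g)"
    by (intro Bochner_Integration.integral_cong) (auto simp: M_def integral_upto_eq(1)[OF g])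
  also have "integral\<^sup>L (M \<Otimes>\<^sub>M M) (\<lambda>(x, y). (if x < y then h x else 0) * g y)
      = (LINT y|M. LINT x|M. (if x < y then h x else 0) * g y)"
    using P.integral_snd[OF tri2] by simp
  also have "\<dots> = (LINT y|M. integral {a..y} h * g y)"
    by (intro Bochner_Integration.integral_cong) (auto simp: M_def integral_upto_eq(2)[OF h])
  finally show ?thesis by (simp add: M_def mult.commute)
qed

text \<open>Splitting the square gives the formula for v - v(a) and w - w(a), which are the running
  integrals; the constants are then restored.\<close>

lemma antideriv_by_parts:
  assumes v: "antideriv a b v g" and w: "antideriv a b w h" and "a \<le> b"
  shows "l2_inner {a<..<b} g w + l2_inner {a<..<b} v h = v b * w b - v a * w a"
proof -
  let ?J = "{a<..<b}"
  note L = antideriv_L2[OF v] antideriv_L2[OF w] antideriv_L2_fun[OF v] antideriv_L2_fun[OF w]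
  have G: "(\<lambda>x. v x - v a) \<in> L2 ?J" "(\<lambda>x. w x - w a) \<in> L2 ?J"
    by (intro L2_diff L L2_continuous continuous_intros)+
  have 1: "(LINT x|lebesgue_on ?J. h x * integral {a..x} g) = l2_inner ?J h (\<lambda>x. v x - v a)"
    unfolding l2_inner_def
    by (intro Bochner_Integration.integral_cong) (simp_all add: antideriv_integral[OF v])
  have 2: "(LINT x|lebesgue_on ?J. g x * integral {a..x} h) = l2_inner ?J g (\<lambda>x. w x - w a)"
    unfolding l2_inner_def
    by (intro Bochner_Integration.integral_cong) (simp_all add: antideriv_integral[OF w])
  have c: "(\<lambda>x. c) \<in> L2 ?J" for c :: real by (intro L2_continuous continuous_intros)
  have k: "l2_inner ?J f (\<lambda>x. c) = c * integral {a..b} f" if "f \<in> L2 ?J" for f c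
    using LINT_eq_integral[OF that] by (simp add: l2_inner_def)
  have "l2_inner ?J g w - w a * integral {a..b} g + (l2_inner ?J h v - v a * integral {a..b} h)
      = integral {a..b} g * integral {a..b} h"
    using integral_by_parts_zero[OF L(1,2)] L c unfolding 1 2
    by (simp add: l2_inner_diff_right k)
  moreover have "integral {a..b} g = v b - v a" "integral {a..b} h = w b - w a"
    using antideriv_eq[OF v, of b] antideriv_eq[OF w, of b] \<open>a \<le> b\<close> by auto
  ultimately show ?thesis
    by (simp add: l2_inner_commute[of _ h v] algebra_simps)
qed

subsection \<open>The fundamental lemma of the calculus of variations\<close>

text \<open>Half-lines are an intersection-stable generator of the Borel sets, and the sets over
  which g integrates to 0 are closed under complements (by \<open>z'\<close>) and disjoint unions.
  So g has zero integral over every Borel set, and the density 0 is unique.\<close>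

lemma AE_zero_if_half_line_integrals_zero:
  fixes g :: "real \<Rightarrow> real"
  assumes g: "integrable lebesgue g" and z: "\<And>c. (LINT x:{c<..}|lebesgue. g x) = 0"
    and z': "integral\<^sup>L lebesgue g = 0"
  shows "AE x in lebesgue. g x = 0"
proof -
  have si: "set_integrable lebesgue A g" if "A \<in> sets lebesgue" for A
    using integrable_mult_indicator[OF that g] by (simp add: set_integrable_def)
  have borel: "B \<in> sets lebesgue" if "B \<in> sets borel" for B :: "real set"
    using that by simp
  have B: "(LINT x:B|lebesgue. g x) = 0" if "B \<in> sets borel" for B
  proof -
    have "Int_stable (range (\<lambda>a::real. {a<..}))"
      by (auto simp: Int_stable_def lessThan_Int_lessThan)
    moreover have "range (\<lambda>a::real. {a<..}) \<subseteq> Pow UNIV" by simp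
    moreover have "B \<in> sigma_sets UNIV (range (\<lambda>a::real. {a<..}))"
      using that by (simp add: borel_Ioi)
    ultimately show ?thesis
    proof (induction rule: sigma_sets_induct_disjoint)
      case (basic A)
      then show ?case using z by auto
    next
      case empty
      then show ?case by (simp add: set_lebesgue_integral_def)
    next
      case (compl A)
      then have A: "A \<in> sets lebesgue" using borel by (simp add: borel_Ioi)
      have "(LINT x:A \<union> (UNIV - A)|lebesgue. g x) = (LINT x:A|lebesgue. g x) + (LINT x:UNIV - A|lebesgue. g x)"
        using si[OF A] si[of "UNIV - A"] sets.compl_sets[OF A] by (intro set_integral_Un) auto
      then show ?case using compl z' by (simp add: set_lebesgue_integral_def)
    next
      case (union A)
      have "A i \<in> sets borel" for i
        using union(2) by (auto simp: borel_Ioi)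
      then have "A i \<in> sets lebesgue" for i using borel by blast
      then have "(LINT x:(\<Union>i. A i)|lebesgue. g x) = (\<Sum>i. LINT x:A i|lebesgue. g x)"
        using union(1) si[of "\<Union>i. A i"]
        by (intro lebesgue_integral_countable_add) (auto simp: disjoint_family_on_def)
      then show ?case using union by simp
    qed
  qed
  have "AE x in lebesgue. g x = (\<lambda>_. 0) x"
  proof (rule density_unique_real[OF g])
    fix A assume "A \<in> sets (lebesgue :: real measure)"
    \<comment> \<open>Every Lebesgue set is a Borel set up to a null set, and the integral ignores
      the latter.\<close>
    then obtain S N N' where A: "A = S \<union> N" "N \<subseteq> N'" "N' \<in> null_sets lborel" "S \<in> sets lborel"
      by (rule sets_completionE)
    have N: "AE x in lebesgue. x \<notin> N"
      using A(2,3) by (intro AE_completion) (auto intro: AE_I')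
    have "(LINT x:A|lebesgue. g x) = (LINT x:S|lebesgue. g x)"
      unfolding set_lebesgue_integral_def
    proof (rule integral_cong_AE)
      show "AE x in lebesgue. indicat_real A x *\<^sub>R g x = indicat_real S x *\<^sub>R g x"
        using N by eventually_elim (auto simp: A(1) indicator_def)
      show "(\<lambda>x. indicat_real A x *\<^sub>R g x) \<in> borel_measurable lebesgue"
        using si[OF \<open>A \<in> sets lebesgue\<close>] by (simp add: set_integrable_def)
      show "(\<lambda>x. indicat_real S x *\<^sub>R g x) \<in> borel_measurable lebesgue"
        using si[of S] A(4) by (simp add: set_integrable_def)
    qed
    then show "(LINT x:A|lebesgue. g x) = (LINT x:A|lebesgue. (\<lambda>_. 0) x)"
      using B[of S] A(4) by simp
  qed simp
  then show ?thesis by simp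
qed

lemma exp_flat_1_tendsto_1:
  assumes "filterlim f at_top F"
  shows "((\<lambda>n. exp_flat 1 (f n)) \<longlongrightarrow> 1) F"
proof (rule Lim_transform_eventually)
  have "((\<lambda>n. exp (- 1 / f n)) \<longlongrightarrow> exp (- 0)) F"
    using tendsto_divide_0[OF tendsto_const filterlim_at_top_imp_at_infinity[OF assms], of "- 1"]
    by (intro tendsto_intros) simp
  then show "((\<lambda>n. exp (- 1 / f n)) \<longlongrightarrow> 1) F" by simp
  show "\<forall>\<^sub>F n in F. exp (- 1 / f n) = exp_flat 1 (f n)"
    using filterlim_at_top_dense[THEN iffD1, OF assms, rule_format, of 0]
    by eventually_elim (simp add: exp_flat_def)
qed

text \<open>For x at most c every bump vanishes, since its support starts to the right of c. For c <
  x < b both factors have arguments m (y m - (b - c)) with m = n + 3 and some y > 0, and these tend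
  to infinity.\<close>

lemma bump_tendsto_indicator:
  assumes "c < b" and x: "x < b"
  shows "(\<lambda>n. bump ((n + 3)\<^sup>2) (c + (b - c) / (real n + 3)) (b - (b - c) / (real n + 3)) x)
     \<longlonglongrightarrow> indicator {c<..} x"
proof -
  define m where "m n = 3 + real n" for n
  have m: "filterlim m at_top sequentially"
    unfolding m_def by (rule filterlim_tendsto_add_at_top[OF tendsto_const filterlim_real_sequentially])
  have lim: "((\<lambda>n. exp_flat 1 (real ((n + 3)\<^sup>2) * (y - (b - c) / m n))) \<longlonglongrightarrow> 1)" if "y > 0" for y
  proof (rule exp_flat_1_tendsto_1)
    have "filterlim (\<lambda>n. y * m n) at_top sequentially"
      by (rule filterlim_tendsto_pos_mult_at_top[OF tendsto_const that m])
    then have "filterlim (\<lambda>n. - (b - c) + y * m n) at_top sequentially"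
      by (rule filterlim_tendsto_add_at_top[OF tendsto_const])
    then have "filterlim (\<lambda>n. y * m n + - (b - c)) at_top sequentially"
      by (simp add: add.commute)
    from filterlim_at_top_mult_at_top[OF m this]
    have "filterlim (\<lambda>n. m n * (y * m n + (- (b - c)))) at_top sequentially" .
    moreover have "m n * (y * m n + (- (b - c))) = real ((n + 3)\<^sup>2) * (y - (b - c) / m n)" for n
      by (simp add: m_def field_simps power2_eq_square)
    ultimately show "filterlim (\<lambda>n. real ((n + 3)\<^sup>2) * (y - (b - c) / m n)) at_top sequentially" by simp
  qed
  show ?thesis
  proof (cases "c < x")
    case True
    have "(\<lambda>n. exp_flat 1 (real ((n + 3)\<^sup>2) * ((x - c) - (b - c) / m n))
        * exp_flat 1 (real ((n + 3)\<^sup>2) * ((b - x) - (b - c) / m n))) \<longlonglongrightarrow> 1 * 1"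
      using True x by (intro tendsto_mult lim) auto
    then show ?thesis using True by (simp add: bump_def m_def algebra_simps)
  next
    case False
    have "bump ((n + 3)\<^sup>2) (c + (b - c) / (real n + 3)) (b - (b - c) / (real n + 3)) x = 0" for n
    proof (rule bump_eq_0)
      have "0 < (b - c) / (real n + 3)" using assms by simp
      then show "x \<notin> {c + (b - c) / (real n + 3)..b - (b - c) / (real n + 3)}"
        using False by auto
    qed
    then show ?thesis using False by simp
  qed
qed

text \<open>Bumps converge boundedly to the indicator of (c,b), so dominated convergence with
  majorant |g| turns the hypothesis into vanishing half-line integrals. Extension by zero moves the
  question to the whole line.\<close>

lemma fundamental_lemma:
  assumes "a < b" and g: "g \<in> L2 {a<..<b}"
    and z: "\<And>\<phi>. \<phi> \<in> test_fun {a<..<b} \<Longrightarrow> l2_inner {a<..<b} g \<phi> = 0"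
  shows "ae_eq {a<..<b} g (\<lambda>x. 0)"
proof -
  let ?J = "{a<..<b}"
  have i: "integrable (lebesgue_on ?J) g" using g by (rule L2_integrable_Ioo)
  have half: "(LINT x|lebesgue_on ?J. g x * indicator {c<..} x) = 0" if c: "a \<le> c" "c < b" for c
  proof -
    define \<phi> where "\<phi> n = bump ((n + 3)\<^sup>2) (c + (b - c) / (real n + 3)) (b - (b - c) / (real n + 3))" for n :: nat
    have pos: "0 < (b - c) / (real n + 3)" for n using c by simp
    have test: "\<phi> n \<in> test_fun ?J" for n
      unfolding \<phi>_def using c pos[of n] by (intro bump_test_fun) (simp_all add: add_strict_increasing2 del: divide_pos_pos)
    have sm: "\<phi> n \<in> L2 ?J" for n
      unfolding \<phi>_def by (intro L2_continuous smooth_fun_continuous smooth_fun_bump)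
    have "(\<lambda>n. LINT x|lebesgue_on ?J. g x * \<phi> n x) \<longlonglongrightarrow> (LINT x|lebesgue_on ?J. g x * indicator {c<..} x)"
    proof (rule integral_dominated_convergence[where w = "\<lambda>x. \<bar>g x\<bar>"])
      have "{x \<in> ?J. x \<in> {c<..}} \<in> sets (lebesgue_on ?J)"
        by (auto simp: sets_restrict_space image_iff intro!: bexI[of _ "{c<..}"])
      then have "(indicator {c<..} :: real \<Rightarrow> real) \<in> borel_measurable (lebesgue_on ?J)"
        by (intro measurable_restrict_space1 measurable_completion) simp
      then show "(\<lambda>x. g x * indicator {c<..} x) \<in> borel_measurable (lebesgue_on ?J)"
        using g by (auto intro: borel_measurable_times L2_measurable)
      show "(\<lambda>x. g x * \<phi> n x) \<in> borel_measurable (lebesgue_on ?J)" for n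
        using g sm by (intro borel_measurable_times L2_measurable)
      show "integrable (lebesgue_on ?J) (\<lambda>x. \<bar>g x\<bar>)" using i by simp
      show "AE x in lebesgue_on ?J. (\<lambda>n. g x * \<phi> n x) \<longlonglongrightarrow> g x * indicator {c<..} x"
        unfolding \<phi>_def using c by (intro AE_I2 tendsto_mult tendsto_const bump_tendsto_indicator) auto
      show "AE x in lebesgue_on ?J. norm (g x * \<phi> n x) \<le> \<bar>g x\<bar>" for n
        unfolding \<phi>_def using bump_bounds by (intro AE_I2) (auto simp: abs_mult mult_left_le)
    qed
    moreover have "(LINT x|lebesgue_on ?J. g x * \<phi> n x) = 0" for n
      using z[OF test] by (simp add: l2_inner_def)
    ultimately show ?thesis by (simp add: LIMSEQ_const_iff)
  qed
  define g0 where "g0 x = (if x \<in> ?J then g x else 0)" for x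
  have cut: "(LINT x:{c<..}|lebesgue. g0 x) = (LINT x|lebesgue_on ?J. g x * indicator {c<..} x)" for c
  proof -
    have "(LINT x:{c<..}|lebesgue. g0 x) = (LINT x|lebesgue. (if x \<in> ?J then g x * indicator {c<..} x else 0))"
      unfolding set_lebesgue_integral_def g0_def by (intro Bochner_Integration.integral_cong) auto
    also have "\<dots> = (LINT x|lebesgue_on ?J. g x * indicator {c<..} x)"
      by (rule Lebesgue_Measure.integral_restrict_UNIV) simp
    finally show ?thesis .
  qed
  have full: "(LINT x|lebesgue_on ?J. g x * indicator {c<..} x) = integral\<^sup>L (lebesgue_on ?J) g" if "c \<le> a" for c
    by (intro Bochner_Integration.integral_cong) (use that in auto)
  \<comment> \<open>The half-line starting at c = a covers the whole interval.\<close>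
  have tot: "integral\<^sup>L (lebesgue_on ?J) g = 0"
    using full[of a] half[of a] \<open>a < b\<close> by simp
  have "AE x in lebesgue. g0 x = 0"
  proof (rule AE_zero_if_half_line_integrals_zero)
    show "integrable lebesgue g0"
      unfolding g0_def using i Lebesgue_Measure.integrable_restrict_UNIV[of ?J g] by simp
    show "integral\<^sup>L lebesgue g0 = 0"
      unfolding g0_def using tot Lebesgue_Measure.integral_restrict_UNIV[of ?J g] by simp
    show "(LINT x:{c<..}|lebesgue. g0 x) = 0" for c
    proof -
      consider "c < a" | "a \<le> c" "c < b" | "b \<le> c" by linarith
      then show ?thesis
      proof cases
        case 1
        then show ?thesis unfolding cut using full[of c] tot by simp
      next
        case 2
        then show ?thesis unfolding cut by (rule half)
      next
        case 3
        have "(LINT x|lebesgue_on ?J. g x * indicator {c<..} x) = (LINT x|lebesgue_on ?J. 0)"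
          by (intro Bochner_Integration.integral_cong) (use 3 in auto)
        then show ?thesis unfolding cut by simp
      qed
    qed
  qed
  then show ?thesis
    unfolding ae_eq_def by (subst AE_restrict_space_iff) (auto simp: g0_def elim!: eventually_mono)
qed

text \<open>The set where v and w disagree inside the interval is open and null, hence empty; the
  end points follow by closure. Point values are well defined because of this.\<close>

lemma continuous_ae_eq_imp_eq:
  assumes "a < b" "continuous_on {a..b} v" "continuous_on {a..b} w" "ae_eq {a<..<b} v w" "x \<in> {a..b}"
  shows "v x = w x"
proof -
  let ?d = "\<lambda>x. v x - w x"
  have cont: "continuous_on {a..b} ?d" using assms by (intro continuous_intros)
  have contJ: "continuous_on {a<..<b} ?d" by (rule continuous_on_subset[OF cont]) auto
  define S where "S = {a<..<b} \<inter> ?d -` (- {0})"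
  have "open S" unfolding S_def using contJ by (intro continuous_open_preimage) auto
  moreover have "negligible S"
  proof -
    have "AE x in lebesgue. x \<notin> S"
      using assms(4) by (auto simp: ae_eq_def AE_restrict_space_iff S_def elim!: eventually_mono)
    then show ?thesis
      by (simp add: negligible_iff_null_sets completion.null_sets_iff_AE)
  qed
  ultimately have "S = {}" using open_not_negligible by blast
  then have "\<And>x. x \<in> {a<..<b} \<Longrightarrow> ?d x = 0" by (auto simp: S_def)
  moreover have "closure {a<..<b} = {a..b}" using assms(1) by simp
  ultimately have "?d x = 0"
    using assms(5) cont continuous_constant_on_closure[of "{a<..<b}" ?d 0 x] by metis
  then show ?thesis by simp
qed

lemma test_fun_antideriv_deriv:
  assumes "a < b" "\<phi> \<in> test_fun {a<..<b}"
  shows "antideriv a b \<phi> (deriv \<phi>)" "\<phi> a = 0" "\<phi> b = 0"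
proof -
  obtain c d where *: "smooth_fun \<phi>" "a < c" "c < d" "d < b" "\<forall>x. x \<notin> {c..d} \<longrightarrow> \<phi> x = 0"
    using assms test_fun_Ioo_iff by blast
  show "antideriv a b \<phi> (deriv \<phi>)"
    by (intro antideriv_DERIV smooth_fun_deriv(1) smooth_fun_continuous smooth_fun_deriv(2) *(1))
  show "\<phi> a = 0" "\<phi> b = 0" using * by auto
qed

lemma test_fun_L2: "\<phi> \<in> test_fun J \<Longrightarrow> \<phi> \<in> L2 {a<..<b}"
  by (auto simp: test_fun_iff intro!: L2_continuous smooth_fun_continuous)

lemma antideriv_weak_deriv:
  assumes "a < b" "antideriv a b v g" "\<phi> \<in> test_fun {a<..<b}"
  shows "l2_inner {a<..<b} v (deriv \<phi>) = - l2_inner {a<..<b} g \<phi>"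
  using antideriv_by_parts[OF assms(2) test_fun_antideriv_deriv(1)[OF assms(1,3)]]
    test_fun_antideriv_deriv(2,3)[OF assms(1,3)] assms(1)
  by simp

text \<open>Otherwise 1 would be orthogonal to all test functions and thus vanish almost everywhere;
  no bump has to be integrated.\<close>

lemma test_fun_nonzero_integral:
  assumes "a < b"
  obtains \<psi> where "\<psi> \<in> test_fun {a<..<b}" "integral {a..b} \<psi> \<noteq> 0"
proof -
  have one: "(\<lambda>x. 1) \<in> L2 {a<..<b}" by (intro L2_continuous continuous_intros)
  have "\<exists>\<psi>\<in>test_fun {a<..<b}. l2_inner {a<..<b} (\<lambda>x. 1) \<psi> \<noteq> 0"
  proof (rule ccontr)
    assume "\<not> ?thesis"
    then have "ae_eq {a<..<b} (\<lambda>x. 1) (\<lambda>x. 0)"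
      by (intro fundamental_lemma assms one) auto
    from continuous_ae_eq_imp_eq[OF assms _ _ this, of a] assms show False by auto
  qed
  then show ?thesis
    using that test_fun_L2 l2_inner_Ioo(1)[OF one] by fastforce
qed

text \<open>The difference w of u and the running integral of g is orthogonal to all derivatives of
  test functions. Every test function becomes such a derivative after subtracting a multiple of the
  fixed \<psi>0, so w - C is orthogonal to all test functions, where C is the value that \<psi>0
  dictates.\<close>

lemma weak_deriv_imp_antideriv:
  assumes "a < b" and u: "u \<in> L2 {a<..<b}" and g: "g \<in> L2 {a<..<b}"
    and wd: "\<And>\<phi>. \<phi> \<in> test_fun {a<..<b} \<Longrightarrow> l2_inner {a<..<b} u (deriv \<phi>) = - l2_inner {a<..<b} g \<phi>"
  obtains v where "antideriv a b v g" "ae_eq {a<..<b} v u"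
proof -
  let ?J = "{a<..<b}"
  define v0 where "v0 x = 0 + integral {a..x} g" for x
  have v0: "antideriv a b v0 g" using antiderivI[OF g, of 0] by (simp add: v0_def[abs_def])
  have v0L: "v0 \<in> L2 ?J" using v0 by (rule antideriv_L2_fun)
  define w where "w x = u x - v0 x" for x
  have w: "w \<in> L2 ?J" unfolding w_def using u v0L by (rule L2_diff)
  have w0: "l2_inner ?J w (deriv \<phi>) = 0" if "\<phi> \<in> test_fun ?J" for \<phi>
    unfolding w_def using wd[OF that] antideriv_weak_deriv[OF assms(1) v0 that] u v0L
      test_fun_L2[OF test_fun_deriv[OF assms(1) that]]
    by (simp add: l2_inner_diff_left)
  obtain \<psi>0 where \<psi>0: "\<psi>0 \<in> test_fun ?J" "integral {a..b} \<psi>0 \<noteq> 0"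
    using test_fun_nonzero_integral[OF assms(1)] .
  define C where "C = l2_inner ?J w \<psi>0 / integral {a..b} \<psi>0"
  have const: "(\<lambda>x. C) \<in> L2 ?J" by (intro L2_continuous continuous_intros)
  have "ae_eq ?J (\<lambda>x. w x - C) (\<lambda>x. 0)"
  proof (rule fundamental_lemma[OF assms(1)])
    show "(\<lambda>x. w x - C) \<in> L2 ?J" using w const by (rule L2_diff)
    fix \<psi> assume \<psi>: "\<psi> \<in> test_fun ?J"
    define k where "k = integral {a..b} \<psi> / integral {a..b} \<psi>0"
    have int: "\<psi> integrable_on {a..b}" "\<psi>0 integrable_on {a..b}"
      using \<psi> \<psi>0 test_fun_L2 L2_integrable by blast+
    have "integral {a..b} (\<lambda>x. \<psi> x - k * \<psi>0 x) = 0"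
      using Henstock_Kurzweil_Integration.integral_diff[OF int(1) integrable_on_cmult_left[OF int(2), of k]]
        \<psi>0(2) by (simp add: k_def)
    then obtain \<phi> where \<phi>: "\<phi> \<in> test_fun ?J" "deriv \<phi> = (\<lambda>x. \<psi> x - k * \<psi>0 x)"
      using test_fun_antideriv[OF assms(1) test_fun_diff_scale[OF \<psi> \<psi>0(1)]] by metis
    have "l2_inner ?J w \<psi> = k * l2_inner ?J w \<psi>0"
      using w0[OF \<phi>(1)] w test_fun_L2[OF \<psi>] test_fun_L2[OF \<psi>0(1)]
      by (simp add: \<phi>(2) l2_inner_diff_right L2_cmult l2_inner_cmult_right)
    moreover have "l2_inner ?J (\<lambda>x. C) \<psi> = C * integral {a..b} \<psi>"
      using l2_inner_Ioo(1)[OF const test_fun_L2[OF \<psi>]] by simp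
    ultimately show "l2_inner ?J (\<lambda>x. w x - C) \<psi> = 0"
      using w const test_fun_L2[OF \<psi>] \<psi>0(2) by (simp add: l2_inner_diff_left C_def k_def)
  qed
  then have "ae_eq ?J (\<lambda>x. C + integral {a..x} g) u"
    unfolding ae_eq_def by eventually_elim (simp add: w_def v0_def)
  with antiderivI[OF g] show ?thesis by (rule that)
qed

subsection \<open>Functions in \<open>H\<^sup>2\<close> of an interval\<close>

text \<open>Here v and v' are the continuous representatives of u and of its weak derivative, and
  v'' is some second derivative in L_2. Carrying all three replaces \<open>wderiv\<close> and
  \<open>point_value\<close> by plain functions in every computation.\<close>

definition h2_rep ::
  "real \<Rightarrow> real \<Rightarrow> (real \<Rightarrow> real) \<Rightarrow> (real \<Rightarrow> real) \<Rightarrow> (real \<Rightarrow> real) \<Rightarrow> (real \<Rightarrow> real) \<Rightarrow> bool" where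
  "h2_rep a b u v v' v'' \<longleftrightarrow> ae_eq {a<..<b} v u \<and> antideriv a b v v' \<and> antideriv a b v' v''"

lemma h2_repD:
  assumes "h2_rep a b u v v' v''"
  shows "ae_eq {a<..<b} v u" "antideriv a b v v'" "antideriv a b v' v''"
    "v \<in> L2 {a<..<b}" "v' \<in> L2 {a<..<b}" "v'' \<in> L2 {a<..<b}"
    "continuous_on {a..b} v" "continuous_on {a..b} v'"
  using assms unfolding h2_rep_def
  by (auto simp: antideriv_L2_fun antideriv_L2 antideriv_continuous)

text \<open>Allows a weak derivative to be replaced by its continuous representative, which is what
  chains two antiderivatives into an \<open>h2_rep\<close>.\<close>

lemma antideriv_cong:
  assumes v: "antideriv a b v g" and ae: "ae_eq {a<..<b} g g'"
  shows "antideriv a b v g'"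
  unfolding antideriv_def
proof (intro conjI ballI)
  show "g' \<in> L2 {a<..<b}" using L2_ae_eq[OF antideriv_L2[OF v] ae] by simp
  fix x assume x: "x \<in> {a..b}"
  have "AE x in lebesgue. x \<in> {a<..<b} \<longrightarrow> g x = g' x"
    using ae by (simp add: ae_eq_def AE_restrict_space_iff)
  then have "negligible {x. \<not> (x \<in> {a<..<b} \<longrightarrow> g x = g' x)}"
    by (simp add: negligible_iff_null_sets completion.AE_iff_null_sets)
  then have "negligible ({x. \<not> (x \<in> {a<..<b} \<longrightarrow> g x = g' x)} \<union> {a, b})"
    by simp
  then have "integral {a..x} g' = integral {a..x} g"
    by (rule integral_spike) (use x in auto)
  then show "v x = v a + integral {a..x} g'"
    using antideriv_eq[OF v x] by simp
qed

lemma is_weak_deriv_unique: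
  assumes "a < b" "g \<in> L2 {a<..<b}" "h \<in> L2 {a<..<b}"
    "is_weak_deriv k {a<..<b} u g" "is_weak_deriv k {a<..<b} u h"
  shows "ae_eq {a<..<b} g h"
proof -
  have "ae_eq {a<..<b} (\<lambda>x. g x - h x) (\<lambda>x. 0)"
    using assms by (intro fundamental_lemma)
      (auto simp: L2_diff l2_inner_diff_left test_fun_L2 is_weak_deriv_def)
  then show ?thesis unfolding ae_eq_def by eventually_elim simp
qed

lemma h2_rep_weak_deriv:
  assumes "a < b" and r: "h2_rep a b u v v' v''"
  shows "is_weak_deriv 1 {a<..<b} u v'" "is_weak_deriv 2 {a<..<b} u v''"
proof -
  let ?J = "{a<..<b}"
  note r' = h2_repD[OF r]
  have u: "l2_inner ?J u \<psi> = l2_inner ?J v \<psi>" if "\<psi> \<in> test_fun ?J" for \<psi>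
    using l2_inner_cong[OF r'(1) ae_eq_refl r'(4) test_fun_L2[OF that]] by simp
  note d = test_fun_deriv[OF assms(1)]
  show "is_weak_deriv 1 ?J u v'"
    using antideriv_weak_deriv[OF assms(1) r'(2)] by (auto simp: is_weak_deriv_def u d)
  show "is_weak_deriv 2 ?J u v''"
    using antideriv_weak_deriv[OF assms(1) r'(2)] antideriv_weak_deriv[OF assms(1) r'(3)]
    by (auto simp: is_weak_deriv_def u d numeral_2_eq_2)
qed

lemma H2_Ioo_iff:
  assumes "a < b"
  shows "u \<in> H2 {a<..<b} \<longleftrightarrow> (\<exists>v v' v''. h2_rep a b u v v' v'')"
proof
  let ?J = "{a<..<b}"
  assume "u \<in> H2 ?J"
  then obtain g1 g2 where u: "u \<in> L2 ?J" and g: "g1 \<in> L2 ?J" "g2 \<in> L2 ?J"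
    and w: "is_weak_deriv 1 ?J u g1" "is_weak_deriv 2 ?J u g2"
    by (auto simp: H2_def)
  have w1: "l2_inner ?J u (deriv \<phi>) = - l2_inner ?J g1 \<phi>" if "\<phi> \<in> test_fun ?J" for \<phi>
    using w(1) that by (auto simp: is_weak_deriv_def)
  obtain v where v: "antideriv a b v g1" "ae_eq ?J v u"
    using weak_deriv_imp_antideriv[OF assms u g(1) w1] by blast
  \<comment> \<open>The derivative of a test function is itself admissible in the first-order
    identity, so the second weak derivative of u is a first weak derivative of g1.\<close>
  have "l2_inner ?J g1 (deriv \<phi>) = - l2_inner ?J g2 \<phi>" if "\<phi> \<in> test_fun ?J" for \<phi>
    using w1[OF test_fun_deriv[OF assms that]] w(2) that by (auto simp: is_weak_deriv_def numeral_2_eq_2)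
  then obtain v' where v': "antideriv a b v' g2" "ae_eq ?J v' g1"
    using weak_deriv_imp_antideriv[OF assms g] by blast
  have "antideriv a b v v'" using antideriv_cong[OF v(1) ae_eq_sym[OF v'(2)]] .
  then show "\<exists>v v' v''. h2_rep a b u v v' v''" using v v' by (auto simp: h2_rep_def)
next
  let ?J = "{a<..<b}"
  assume "\<exists>v v' v''. h2_rep a b u v v' v''"
  then obtain v v' v'' where r: "h2_rep a b u v v' v''" by blast
  note r' = h2_repD[OF r]
  have "u \<in> L2 ?J" using L2_ae_eq[OF r'(4) r'(1)] by simp
  then show "u \<in> H2 ?J"
    using r' h2_rep_weak_deriv[OF assms r] by (auto simp: H2_def)
qed

text \<open>The choice made by \<open>SOME\<close> is fixed only up to null sets; this is the access
  to it used from here on.\<close>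

lemma wderiv_ae_eq:
  assumes "a < b" "g \<in> L2 {a<..<b}" "is_weak_deriv k {a<..<b} u g"
  shows "ae_eq {a<..<b} g (wderiv k {a<..<b} u)"
proof -
  have "wderiv k {a<..<b} u \<in> L2 {a<..<b} \<and> is_weak_deriv k {a<..<b} u (wderiv k {a<..<b} u)"
    unfolding wderiv_def by (rule someI[of _ g]) (use assms in simp)
  then show ?thesis using is_weak_deriv_unique assms by blast
qed

lemma h2_rep_wderiv:
  assumes "a < b" "h2_rep a b u v v' v''"
  shows "ae_eq {a<..<b} v' (wderiv 1 {a<..<b} u)" "ae_eq {a<..<b} v'' (wderiv 2 {a<..<b} u)"
  using wderiv_ae_eq[OF assms(1)] h2_rep_weak_deriv[OF assms] h2_repD[OF assms(2)] by blast+

lemma point_value_eq: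
  assumes "a < b" "continuous_on {a..b} v" "ae_eq {a<..<b} v u" "p \<in> {a..b}"
  shows "point_value {a<..<b} u p = v p"
  unfolding point_value_def
proof (rule the_equality)
  have cl: "closure {a<..<b} = {a..b}" using assms(1) by simp
  show "\<exists>w. continuous_on (closure {a<..<b}) w \<and> ae_eq {a<..<b} w u \<and> w p = v p"
    using assms unfolding cl by blast
  fix y assume "\<exists>w. continuous_on (closure {a<..<b}) w \<and> ae_eq {a<..<b} w u \<and> w p = y"
  then obtain w where w: "continuous_on {a..b} w" "ae_eq {a<..<b} w u" "w p = y"
    unfolding cl by blast
  then show "y = v p"
    using continuous_ae_eq_imp_eq[OF assms(1) assms(2) w(1) ae_eq_trans[OF assms(3) ae_eq_sym[OF w(2)]] assms(4)]
    by simp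
qed

lemma h2_rep_point_value:
  assumes "a < b" "h2_rep a b u v v' v''" "p \<in> {a..b}"
  shows "point_value {a<..<b} u p = v p" "point_value {a<..<b} (wderiv 1 {a<..<b} u) p = v' p"
  using point_value_eq[OF assms(1) _ _ assms(3)] h2_repD[OF assms(2)] h2_rep_wderiv(1)[OF assms(1,2)]
  by blast+

lemma h2_rep_subinterval:
  assumes "h2_rep a b u v v' v''" "a \<le> c" "c < d" "d \<le> b"
  shows "h2_rep c d u v v' v''"
proof -
  have "{c<..<d} \<subseteq> {a<..<b}" using assms by auto
  then show ?thesis
    using assms antideriv_subinterval[of a b _ _ c d] ae_eq_subset[of "{a<..<b}" v u "{c<..<d}"]
    by (auto simp: h2_rep_def)
qed

text \<open>Integrating by parts once from either side produces the same term (v',w'), which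
  cancels.\<close>

lemma h2_rep_green:
  assumes "a \<le> b" "h2_rep a b u v v' v''" "h2_rep a b z w w' w''"
  shows "l2_inner {a<..<b} v w'' - l2_inner {a<..<b} v'' w
    = (v b * w' b - v a * w' a) - (v' b * w b - v' a * w a)"
  using antideriv_by_parts[OF h2_repD(2)[OF assms(2)] h2_repD(3)[OF assms(3)] assms(1)]
    antideriv_by_parts[OF h2_repD(3)[OF assms(2)] h2_repD(2)[OF assms(3)] assms(1)]
  by simp

subsection \<open>Traces on a mesh\<close>

lemma mesh_less: "is_mesh n x \<Longrightarrow> j \<in> {1..n} \<Longrightarrow> x (j - 1) < x j"
  by (auto simp: is_mesh_def)

lemma mesh_mono:
  assumes "is_mesh n x" "i \<le> j" "j \<le> n"
  shows "x i \<le> x j"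
  using assms(2,3)
proof (induction j rule: dec_induct)
  case (step j)
  then have "x j < x (Suc j)" using mesh_less[OF assms(1), of "Suc j"] by simp
  with step show ?case by simp
qed simp

lemma mesh_bounds:
  assumes "is_mesh n x" "j \<le> n"
  shows "0 \<le> x j" "x j \<le> 1"
  using mesh_mono[OF assms(1), of 0 j] mesh_mono[OF assms(1), of j n] assms by (auto simp: is_mesh_def)

lemma mesh_elem_bounds:
  assumes "is_mesh n x" "j \<in> {1..n}"
  shows "0 \<le> x (j - 1)" "x (j - 1) < x j" "x j \<le> 1"
  using mesh_bounds[OF assms(1)] mesh_less[OF assms] assms(2) by auto

lemma mesh_telescope:
  fixes F :: "real \<Rightarrow> real"
  assumes "is_mesh n x"
  shows "(\<Sum>j = 1..n. F (x j) - F (x (j - 1))) = F 1 - F 0"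
proof -
  have "(\<Sum>j = 1..m. F (x j) - F (x (j - 1))) = F (x m) - F (x 0)" for m
    by (induction m) auto
  then show ?thesis using assms by (simp add: is_mesh_def)
qed

lemma elem_subset_unit: "is_mesh n x \<Longrightarrow> j \<in> {1..n} \<Longrightarrow> elem x j \<subseteq> unit_ivl"
  using mesh_elem_bounds by (fastforce simp: elem_def)

lemma elem_measurable [simp]: "elem x j \<in> sets lebesgue"
  by (simp add: elem_def)

lemma H2_unit_imp_H2_elem:
  assumes "is_mesh n x" "j \<in> {1..n}" "u \<in> H2 unit_ivl"
  shows "u \<in> H2 (elem x j)"
proof -
  obtain v v' v'' where "h2_rep 0 1 u v v' v''" using assms(3) H2_Ioo_iff[of 0 1 u] by auto
  from h2_rep_subinterval[OF this] mesh_elem_bounds[OF assms(1,2)]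
  have "h2_rep (x (j - 1)) (x j) u v v' v''" by simp
  then show ?thesis using H2_Ioo_iff[of "x (j - 1)" "x j"] mesh_less[OF assms(1,2)] by (auto simp: elem_def)
qed

lemma H2_unit_imp_H2_mesh: "is_mesh n x \<Longrightarrow> u \<in> H2 unit_ivl \<Longrightarrow> u \<in> H2_mesh n x"
  using H2_unit_imp_H2_elem by (auto simp: H2_mesh_def H2_def)

lemma H2_elem_rep:
  assumes "is_mesh n x" "j \<in> {1..n}" "u \<in> H2 (elem x j)"
  obtains v v' v'' where "h2_rep (x (j - 1)) (x j) u v v' v''"
  using assms H2_Ioo_iff[OF mesh_less[OF assms(1,2)]] by (auto simp: elem_def)

lemma trace_elem_eq:
  assumes "x (j - 1) < x j" "h2_rep (x (j - 1)) (x j) u v v' v''"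
  shows "trace_elem x j u = (v (x (j - 1)), v' (x (j - 1)), v (x j), v' (x j))"
  using assms h2_rep_point_value[OF assms] by (simp add: trace_elem_def elem_def)

text \<open>One summand of \<open>fun_pairing\<close>, written in the sixteen boundary numbers. In
  this form it is evident that the pairing depends on u and M through their traces alone.\<close>

fun elem_pairing :: "real \<Rightarrow> elem_trace \<Rightarrow> elem_trace \<Rightarrow> elem_trace \<Rightarrow> elem_trace \<Rightarrow> real" where
  "elem_pairing t (u0, du0, u1, du1) (M0, dM0, M1, dM1) (z0, dz0, z1, dz1) (W0, dW0, W1, dW1) =
     - (u1 * dW1 - u0 * dW0) + (dM1 * z1 - dM0 * z0)
     - (M1 * (dz1 - t\<^sup>2 * dW1) - M0 * (dz0 - t\<^sup>2 * dW0))
     + ((du1 - t\<^sup>2 * dM1) * W1 - (du0 - t\<^sup>2 * dM0) * W0)"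

lemma fun_pairing_eq:
  assumes m: "is_mesh n x"
    and H: "\<And>j. j \<in> {1..n} \<Longrightarrow> u \<in> H2 (elem x j) \<and> M \<in> H2 (elem x j) \<and> z \<in> H2 (elem x j) \<and> W \<in> H2 (elem x j)"
  shows "fun_pairing t n x (u, M) (z, W) =
    (\<Sum>j = 1..n. elem_pairing t (trace_elem x j u) (trace_elem x j M) (trace_elem x j z) (trace_elem x j W))"
  unfolding fun_pairing_def prod.case
proof (rule sum.cong[OF refl])
  fix j assume j: "j \<in> {1..n}"
  let ?a = "x (j - 1)" and ?b = "x j"
  have ab: "?a < ?b" using mesh_less[OF m j] .
  obtain v v' v'' where v: "h2_rep ?a ?b u v v' v''" using H2_elem_rep[OF m j] H[OF j] by metis
  obtain N N' N'' where N: "h2_rep ?a ?b M N N' N''" using H2_elem_rep[OF m j] H[OF j] by metis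
  obtain y y' y'' where y: "h2_rep ?a ?b z y y' y''" using H2_elem_rep[OF m j] H[OF j] by metis
  obtain w w' w'' where w: "h2_rep ?a ?b W w w' w''" using H2_elem_rep[OF m j] H[OF j] by metis
  define d where "d = wderiv 1 (elem x j)"
  note [simp] = h2_rep_point_value[OF ab v, folded elem_def, folded d_def] h2_rep_point_value[OF ab N, folded elem_def, folded d_def]
    h2_rep_point_value[OF ab y, folded elem_def, folded d_def] h2_rep_point_value[OF ab w, folded elem_def, folded d_def]
  \<comment> \<open>The chosen derivatives are arbitrary on null sets, so linearity of the point
    value has to come from the continuous representative of the whole combination.\<close>
  have comb: "point_value (elem x j) (\<lambda>s. d z s - t\<^sup>2 * d W s) p = y' p - t\<^sup>2 * w' p"
    "point_value (elem x j) (\<lambda>s. d u s - t\<^sup>2 * d M s) p = v' p - t\<^sup>2 * N' p"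
    if "p \<in> {?a..?b}" for p
    unfolding d_def elem_def
    using point_value_eq[OF ab
        continuous_on_diff[OF h2_repD(8)[OF y] continuous_on_mult_left[OF h2_repD(8)[OF w], of "t\<^sup>2"]]
        ae_eq_diff[OF h2_rep_wderiv(1)[OF ab y] ae_eq_cmult[OF h2_rep_wderiv(1)[OF ab w], of "t\<^sup>2"]] that]
      point_value_eq[OF ab
        continuous_on_diff[OF h2_repD(8)[OF v] continuous_on_mult_left[OF h2_repD(8)[OF N], of "t\<^sup>2"]]
        ae_eq_diff[OF h2_rep_wderiv(1)[OF ab v] ae_eq_cmult[OF h2_rep_wderiv(1)[OF ab N], of "t\<^sup>2"]] that]
    by simp_all
  show "(let d = wderiv 1 (elem x j)
      in - bracket x j u (d W) + bracket x j (d M) z - bracket x j M (\<lambda>s. d z s - t\<^sup>2 * d W s)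
        + bracket x j (\<lambda>s. d u s - t\<^sup>2 * d M s) W)
    = elem_pairing t (trace_elem x j u) (trace_elem x j M) (trace_elem x j z) (trace_elem x j W)"
    using ab unfolding d_def[symmetric] Let_def bracket_def trace_elem_def by (simp add: comb)
qed

text \<open>Any two pairs with the same trace give the same sum of \<open>elem_pairing\<close>, so
  the definite description denotes.\<close>

lemma trace_pairing_eq:
  assumes m: "is_mesh n x" and uM: "u \<in> H2 unit_ivl" "M \<in> H2 unit_ivl"
    and zW: "(z, W) \<in> test_space n x"
  shows "trace_pairing t n x (trace2 n x (u, M)) (z, W) =
    (\<Sum>j = 1..n. elem_pairing t (trace_elem x j u) (trace_elem x j M) (trace_elem x j z) (trace_elem x j W))"
proof -
  have eq: "fun_pairing t n x (u, M) (z, W) =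
    (\<Sum>j = 1..n. elem_pairing t (trace_elem x j u) (trace_elem x j M) (trace_elem x j z) (trace_elem x j W))"
    if "u \<in> H2 unit_ivl" "M \<in> H2 unit_ivl" for u M
    using that zW H2_unit_imp_H2_elem[OF m]
    by (intro fun_pairing_eq[OF m]) (auto simp: test_space_def H2_mesh_def)
  show ?thesis
    unfolding trace_pairing_def
  proof (rule the_equality)
    show "\<exists>u'\<in>H2 unit_ivl. \<exists>M'\<in>H2 unit_ivl. trace2 n x (u', M') = trace2 n x (u, M) \<and>
      (\<Sum>j = 1..n. elem_pairing t (trace_elem x j u) (trace_elem x j M) (trace_elem x j z) (trace_elem x j W))
      = fun_pairing t n x (u', M') (z, W)"
      by (intro bexI[of _ u] bexI[of _ M] conjI refl eq[OF uM, symmetric] uM)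
    fix c assume "\<exists>u'\<in>H2 unit_ivl. \<exists>M'\<in>H2 unit_ivl. trace2 n x (u', M') = trace2 n x (u, M) \<and>
      c = fun_pairing t n x (u', M') (z, W)"
    then obtain u' M' where *: "u' \<in> H2 unit_ivl" "M' \<in> H2 unit_ivl"
      "trace1 n x u' = trace1 n x u" "trace1 n x M' = trace1 n x M" "c = fun_pairing t n x (u', M') (z, W)"
      by (auto simp: trace2_def)
    have "trace_elem x j u' = trace_elem x j u" "trace_elem x j M' = trace_elem x j M" if "j \<in> {1..n}" for j
      using fun_cong[OF *(3), of j] fun_cong[OF *(4), of j] that by (auto simp: trace1_def)
    then show "c = (\<Sum>j = 1..n. elem_pairing t (trace_elem x j u) (trace_elem x j M) (trace_elem x j z) (trace_elem x j W))"
      unfolding *(5) eq[OF *(1,2)] by (intro sum.cong) auto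
  qed
qed

text \<open>Each element contributes an increment of the running integral of f g, and increments
  telescope.\<close>

lemma sum_l2_inner_elem:
  assumes m: "is_mesh n x" and f: "f \<in> L2 unit_ivl" and g: "g \<in> L2 unit_ivl"
  shows "(\<Sum>j = 1..n. l2_inner (elem x j) f g) = l2_inner unit_ivl f g"
proof -
  let ?h = "\<lambda>s. f s * g s"
  have i: "?h integrable_on {0..1}" using l2_inner_Ioo(2)[OF f g] .
  have "l2_inner (elem x j) f g = integral {0..x j} ?h - integral {0..x (j - 1)} ?h" if j: "j \<in> {1..n}" for j
  proof -
    note b = mesh_elem_bounds[OF m j]
    have "f \<in> L2 (elem x j)" "g \<in> L2 (elem x j)"
      using f g elem_subset_unit[OF m j] by (auto intro: L2_subset)
    then have "l2_inner (elem x j) f g = integral {x (j - 1)..x j} ?h"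
      unfolding elem_def by (rule l2_inner_Ioo(1))
    moreover have "integral {0..x (j - 1)} ?h + integral {x (j - 1)..x j} ?h = integral {0..x j} ?h"
      by (rule Henstock_Kurzweil_Integration.integral_combine)
        (use b integrable_on_subinterval[OF i] in auto)
    ultimately show ?thesis by simp
  qed
  then have "(\<Sum>j = 1..n. l2_inner (elem x j) f g) = (\<Sum>j = 1..n. integral {0..x j} ?h - integral {0..x (j - 1)} ?h)"
    by (intro sum.cong) auto
  also have "\<dots> = integral {0..1} ?h - integral {0..0} ?h"
    by (rule mesh_telescope[OF m, of "\<lambda>s. integral {0..s} ?h"])
  also have "\<dots> = l2_inner unit_ivl f g" using l2_inner_Ioo(1)[OF f g] by simp
  finally show ?thesis .
qed

subsection \<open>The boundary value problem\<close>

text \<open>The end conditions on eight bare reals, so that they can be solved as linear algebra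
  before any function is built.\<close>

definition bc_values ::
  "bc \<Rightarrow> real \<Rightarrow> real \<Rightarrow> real \<Rightarrow> real \<Rightarrow> real \<Rightarrow> real \<Rightarrow> real \<Rightarrow> real \<Rightarrow> real \<Rightarrow> bool" where
  "bc_values a t u0 du0 u1 du1 M0 dM0 M1 dM1 = (case a of
     CC \<Rightarrow> u0 = 0 \<and> du0 - t\<^sup>2 * dM0 = 0 \<and> u1 = 0 \<and> du1 - t\<^sup>2 * dM1 = 0
   | CS \<Rightarrow> u0 = 0 \<and> du0 - t\<^sup>2 * dM0 = 0 \<and> u1 = 0 \<and> M1 = 0
   | CF \<Rightarrow> u0 = 0 \<and> du0 - t\<^sup>2 * dM0 = 0 \<and> M1 = 0 \<and> dM1 = 0
   | SS \<Rightarrow> u0 = 0 \<and> M0 = 0 \<and> u1 = 0 \<and> M1 = 0)"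

lemma H2_bc_iff:
  assumes "h2_rep 0 1 u v v' v''" "h2_rep 0 1 M N N' N''"
  shows "(u, M) \<in> H2_bc a t \<longleftrightarrow> bc_values a t (v 0) (v' 0) (v 1) (v' 1) (N 0) (N' 0) (N 1) (N' 1)"
proof -
  have "u \<in> H2 unit_ivl" "M \<in> H2 unit_ivl"
    using assms H2_Ioo_iff[of 0 1] by auto
  moreover note pv = h2_rep_point_value[OF zero_less_one assms(1)] h2_rep_point_value[OF zero_less_one assms(2)]
  have "point_value unit_ivl u 0 = v 0" "point_value unit_ivl u 1 = v 1"
    "point_value unit_ivl (wderiv 1 unit_ivl u) 0 = v' 0" "point_value unit_ivl (wderiv 1 unit_ivl u) 1 = v' 1"
    "point_value unit_ivl M 0 = N 0" "point_value unit_ivl M 1 = N 1"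
    "point_value unit_ivl (wderiv 1 unit_ivl M) 0 = N' 0" "point_value unit_ivl (wderiv 1 unit_ivl M) 1 = N' 1"
    by (rule pv; simp)+
  ultimately show ?thesis
    unfolding H2_bc_def bc_values_def Let_def mem_Collect_eq prod.case by (simp only: simp_thms)
qed

text \<open>Meant for pivots k = t^2 + 1/c, which stay at least 1/c for all t; this is where
  uniformity in t enters.\<close>

lemma abs_div_le:
  fixes r s :: real
  assumes "\<bar>r\<bar> \<le> N" "0 < k" "1 \<le> c * k" "0 \<le> c"
  shows "\<bar>r / k\<bar> \<le> c * N"
proof -
  have "0 \<le> N" using assms(1) by linarith
  have "\<bar>r / k\<bar> = \<bar>r\<bar> / k" using assms by simp
  also have "\<dots> \<le> N / k" using assms by (intro divide_right_mono) auto
  also have "\<dots> \<le> (c * k * N) / k"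
    using assms \<open>0 \<le> N\<close> mult_right_mono[OF assms(3) \<open>0 \<le> N\<close>] by (intro divide_right_mono) auto
  also have "\<dots> = c * N" using assms by simp
  finally show ?thesis .
qed

text \<open>With \<open>W = \<alpha> + \<beta> x + F\<^sub>2\<close> and \<open>z = \<delta> + t\<^sup>2 W + \<gamma> x + G\<^sub>2 - \<alpha> x\<^sup>2 / 2 - \<beta> x\<^sup>3 / 6 - F\<^sub>4\<close>, where
  \<open>F\<^sub>k\<close>, \<open>G\<^sub>k\<close> are iterated antiderivatives of the data, the boundary conditions are a linear system
  for the four constants whose pivot is \<open>t\<^sup>2 + 1 / 12\<close>, \<open>t\<^sup>2 + 1 / 3\<close> or \<open>1\<close>, so it is solvable uniformly in \<open>t\<close>.\<close>

lemma bc_constants: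
  fixes t F1 F2 F3 F4 G1 G2 N :: real
  assumes t: "t \<in> {0..1}"
    and b: "\<bar>F1\<bar> \<le> N" "\<bar>F2\<bar> \<le> N" "\<bar>F3\<bar> \<le> N" "\<bar>F4\<bar> \<le> N" "\<bar>G1\<bar> \<le> N" "\<bar>G2\<bar> \<le> N"
  obtains \<alpha> \<beta> \<gamma> \<delta> :: real where
    "\<bar>\<alpha>\<bar> \<le> 100 * N" "\<bar>\<beta>\<bar> \<le> 100 * N" "\<bar>\<gamma>\<bar> \<le> 100 * N" "\<bar>\<delta>\<bar> \<le> 100 * N"
    "bc_values a t (\<delta> + t\<^sup>2 * \<alpha>) (t\<^sup>2 * \<beta> + \<gamma>)
       (\<delta> + t\<^sup>2 * (\<alpha> + \<beta> + F2) + \<gamma> + G2 - \<alpha> / 2 - \<beta> / 6 - F4)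
       (t\<^sup>2 * (\<beta> + F1) + \<gamma> + G1 - \<alpha> - \<beta> / 2 - F3)
       \<alpha> \<beta> (\<alpha> + \<beta> + F2) (\<beta> + F1)"
proof -
  have T: "0 \<le> t\<^sup>2" "t\<^sup>2 \<le> 1" using t by (auto simp: power_le_one)
  have N: "0 \<le> N" using b(1) by linarith
  have tm: "\<bar>t\<^sup>2 * r\<bar> \<le> K" if "\<bar>r\<bar> \<le> K" for r K
  proof -
    have "\<bar>t\<^sup>2 * r\<bar> \<le> 1 * \<bar>r\<bar>" unfolding abs_mult using T by (intro mult_right_mono) auto
    then show ?thesis using that by linarith
  qed
  show thesis
  proof (cases a)
    case CC
    \<comment> \<open>The left end forces \<gamma> = 0 and \<delta> = -t^2 \<alpha>. The slope
      condition at 1 expresses \<alpha> by \<beta>; in u(1) = 0 the coefficient of \<beta> is then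
      t^2 + 1/4 - 1/6.\<close>
    define \<beta> where "\<beta> = (F4 - G2 + (G1 - F3) / 2 - t\<^sup>2 * F2) / (t\<^sup>2 + 1 / 12)"
    define \<alpha> where "\<alpha> = G1 - F3 - \<beta> / 2"
    have k: "t\<^sup>2 + 1 / 12 > 0" using T by linarith
    have "\<bar>F4 - G2 + (G1 - F3) / 2 - t\<^sup>2 * F2\<bar> \<le> 4 * N"
    proof -
      have "\<bar>F4 - G2\<bar> \<le> 2 * N" using b(4,6) by linarith
      moreover define r where "r = (G1 - F3) / 2"
      moreover have "\<bar>2 * r\<bar> \<le> 2 * N" unfolding r_def using b(3,5) by simp
      ultimately show ?thesis using tm[OF b(2)] unfolding r_def[symmetric] by linarith
    qed
    then have \<beta>: "\<bar>\<beta>\<bar> \<le> 12 * (4 * N)"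
      unfolding \<beta>_def by (rule abs_div_le[OF _ k]) (simp_all add: distrib_left)
    have "(t\<^sup>2 + 1 / 12) * \<beta> = F4 - G2 + (G1 - F3) / 2 - t\<^sup>2 * F2"
      unfolding \<beta>_def using k by simp
    then have "bc_values CC t (- t\<^sup>2 * \<alpha> + t\<^sup>2 * \<alpha>) (t\<^sup>2 * \<beta> + 0)
       (- t\<^sup>2 * \<alpha> + t\<^sup>2 * (\<alpha> + \<beta> + F2) + 0 + G2 - \<alpha> / 2 - \<beta> / 6 - F4)
       (t\<^sup>2 * (\<beta> + F1) + 0 + G1 - \<alpha> - \<beta> / 2 - F3)
       \<alpha> \<beta> (\<alpha> + \<beta> + F2) (\<beta> + F1)"
      by (simp add: bc_values_def \<alpha>_def algebra_simps diff_divide_distrib add_divide_distrib)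
    moreover have \<alpha>: "\<bar>\<alpha>\<bar> \<le> 100 * N" unfolding \<alpha>_def using \<beta> b by linarith
    moreover have "\<bar>- t\<^sup>2 * \<alpha>\<bar> \<le> 100 * N" using tm[OF \<alpha>] by simp
    ultimately show ?thesis using that[of \<alpha> \<beta> 0 "- t\<^sup>2 * \<alpha>"] \<beta> N CC by simp
  next
    case CS
    \<comment> \<open>Again \<gamma> = 0 and \<delta> = -t^2 \<alpha>; M(1) = 0 gives \<beta>, and
      u(1) = 0 leaves t^2 + 1/2 - 1/6 as coefficient of \<alpha>.\<close>
    define \<alpha> where "\<alpha> = (F2 / 6 + G2 - F4) / (t\<^sup>2 + 1 / 3)"
    define \<beta> where "\<beta> = - \<alpha> - F2"
    have k: "t\<^sup>2 + 1 / 3 > 0" using T by linarith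
    have \<alpha>: "\<bar>\<alpha>\<bar> \<le> 3 * (3 * N)"
      unfolding \<alpha>_def
    proof (rule abs_div_le[OF _ k])
      show "\<bar>F2 / 6 + G2 - F4\<bar> \<le> 3 * N" using b(2,4,6) by linarith
    qed (simp_all add: distrib_left)
    have "(t\<^sup>2 + 1 / 3) * \<alpha> = F2 / 6 + G2 - F4"
      unfolding \<alpha>_def using k by simp
    then have "bc_values CS t (- t\<^sup>2 * \<alpha> + t\<^sup>2 * \<alpha>) (t\<^sup>2 * \<beta> + 0)
       (- t\<^sup>2 * \<alpha> + t\<^sup>2 * (\<alpha> + \<beta> + F2) + 0 + G2 - \<alpha> / 2 - \<beta> / 6 - F4)
       (t\<^sup>2 * (\<beta> + F1) + 0 + G1 - \<alpha> - \<beta> / 2 - F3)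
       \<alpha> \<beta> (\<alpha> + \<beta> + F2) (\<beta> + F1)"
      by (simp add: bc_values_def \<beta>_def algebra_simps diff_divide_distrib add_divide_distrib)
    moreover have "\<bar>\<beta>\<bar> \<le> 100 * N" unfolding \<beta>_def using \<alpha> b N by linarith
    moreover have "\<bar>- t\<^sup>2 * \<alpha>\<bar> \<le> 100 * N" using tm[OF \<alpha>] N by simp
    ultimately show ?thesis using that[of \<alpha> \<beta> 0 "- t\<^sup>2 * \<alpha>"] \<alpha> N CS by simp
  next
    case CF
    have \<alpha>: "\<bar>F1 - F2\<bar> \<le> 100 * N" using b N by linarith
    have "bc_values CF t (- t\<^sup>2 * (F1 - F2) + t\<^sup>2 * (F1 - F2)) (t\<^sup>2 * (- F1) + 0) u1 du1
       (F1 - F2) (- F1) (F1 - F2 + - F1 + F2) (- F1 + F1)" for u1 du1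
      by (simp add: bc_values_def)
    then show ?thesis
      using that[of "F1 - F2" "- F1" 0 "- t\<^sup>2 * (F1 - F2)"] CF \<alpha> tm[OF \<alpha>] b N by simp
  next
    case SS
    \<comment> \<open>M(0) = u(0) = 0 give \<alpha> = \<delta> = 0 and M(1) = 0 gives \<beta> = -F2,
      so only u(1) = 0 is left.\<close>
    define \<gamma> where "\<gamma> = F4 - G2 - F2 / 6"
    have "\<bar>\<gamma>\<bar> \<le> 100 * N" "\<bar>- F2\<bar> \<le> 100 * N" unfolding \<gamma>_def using b N by linarith+
    then show ?thesis
      using that[of 0 "- F2" \<gamma> 0] SS N by (simp add: bc_values_def \<gamma>_def)
  qed
qed

section \<open>Solution of the boundary value problem with uniform bounds\<close>

lemma l2_inner_le_of_bounded:
  assumes f: "f \<in> L2 {a<..<b}" and "a \<le> b" and bd: "\<And>s. s \<in> {a..b} \<Longrightarrow> \<bar>f s\<bar> \<le> S"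
  shows "l2_inner {a<..<b} f f \<le> (b - a) * S\<^sup>2"
proof -
  have "integral {a..b} (\<lambda>s. f s * f s) \<le> integral {a..b} (\<lambda>s. S\<^sup>2)"
  proof (rule integral_le)
    show "f s * f s \<le> S\<^sup>2" if "s \<in> {a..b}" for s
      using power_mono[OF bd[OF that], of 2] by (simp add: power2_eq_square)
  qed (use l2_inner_Ioo(2)[OF f f] in auto)
  then show ?thesis using l2_inner_Ioo(1)[OF f f] \<open>a \<le> b\<close> by simp
qed

text \<open>Cauchy-Schwarz against the constant 1 on (0,x), whose squared norm is x and so at most
  1.\<close>

lemma abs_integral_le_l2_norm:
  assumes g: "g \<in> L2 unit_ivl" and x: "x \<in> {0..1}"
  shows "\<bar>integral {0..x} g\<bar> \<le> l2_norm unit_ivl g"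
proof -
  have "{0<..<x} \<subseteq> unit_ivl" using x by auto
  then have L: "g \<in> L2 {0<..<x}" using L2_subset[OF g, of "{0<..<x}"] by simp
  have one: "(\<lambda>s. 1) \<in> L2 {0<..<x}" by (intro L2_continuous continuous_intros)
  have i: "l2_inner {0<..<x} g g \<le> l2_inner unit_ivl g g"
    unfolding l2_inner_Ioo(1)[OF L L] l2_inner_Ioo(1)[OF g g]
    by (rule integral_subset_le) (use x l2_inner_Ioo(2)[OF L L] l2_inner_Ioo(2)[OF g g] in auto)
  have "(integral {0..x} g)\<^sup>2 = (l2_inner {0<..<x} g (\<lambda>s. 1))\<^sup>2"
    using l2_inner_Ioo(1)[OF L one] by simp
  also have "\<dots> \<le> l2_inner {0<..<x} g g * l2_inner {0<..<x} (\<lambda>s. 1) (\<lambda>s. 1)"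
    by (rule l2_Cauchy_Schwarz[OF L one])
  also have "\<dots> = l2_inner {0<..<x} g g * x"
    using l2_inner_Ioo(1)[OF one one] x by simp
  also have "\<dots> \<le> l2_inner {0<..<x} g g" using x by (simp add: mult_left_le l2_inner_nonneg)
  also have "\<dots> \<le> (l2_norm unit_ivl g)\<^sup>2" using i by (simp add: l2_norm_sq)
  finally show ?thesis
    using power2_le_imp_le[of "\<bar>integral {0..x} g\<bar>" "l2_norm unit_ivl g"] by (simp add: l2_norm_nonneg)
qed

lemma abs_integral_le_bound:
  assumes g: "continuous_on {0..1} g" and bd: "\<And>s. s \<in> {0..1} \<Longrightarrow> \<bar>g s\<bar> \<le> K" and x: "x \<in> {0..1::real}"
  shows "\<bar>integral {0..x} g\<bar> \<le> (K::real)"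
proof -
  have "0 \<le> K" using bd[of 0] by auto
  have "norm (integral {0..x} g) \<le> K * (x - 0)"
    by (rule integral_bound) (use x bd continuous_on_subset[OF g] in auto)
  also have "\<dots> \<le> K" using x \<open>0 \<le> K\<close> by (simp add: mult_left_le)
  finally show ?thesis by simp
qed

text \<open>Serves twice: with data (-f, 0) it yields the solution, with arbitrary F and G the dual
  test functions. The constants are at most 100 N; adding the term bounds for z gives 201 + 100 +
  100 + 50 + 20 + 1 + 1 = 473, rounded up to 500.\<close>

lemma bvp_exists:
  assumes t: "t \<in> {0..1}" and F: "F \<in> L2 unit_ivl" and G: "G \<in> L2 unit_ivl"
  obtains z z' W W' where
    "h2_rep 0 1 z z z' (\<lambda>s. t\<^sup>2 * F s + G s - W s)" "h2_rep 0 1 W W W' F" "(z, W) \<in> H2_bc a t"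
    "\<forall>s\<in>{0..1}. \<bar>z s\<bar> \<le> 500 * (l2_norm unit_ivl F + l2_norm unit_ivl G) \<and>
      \<bar>z' s\<bar> \<le> 500 * (l2_norm unit_ivl F + l2_norm unit_ivl G) \<and>
      \<bar>W s\<bar> \<le> 500 * (l2_norm unit_ivl F + l2_norm unit_ivl G) \<and>
      \<bar>W' s\<bar> \<le> 500 * (l2_norm unit_ivl F + l2_norm unit_ivl G)"
proof -
  define N where "N = l2_norm unit_ivl F + l2_norm unit_ivl G"
  have "0 \<le> N" unfolding N_def by (intro add_nonneg_nonneg l2_norm_nonneg)
  have nn: "0 \<le> l2_norm unit_ivl F" "0 \<le> l2_norm unit_ivl G" by (rule l2_norm_nonneg)+
  define I where "I g x = integral {0..x} g" for g :: "real \<Rightarrow> real" and x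
  have I: "antideriv 0 1 (I g) g" if "g \<in> L2 unit_ivl" for g
    using antiderivI[OF that, of 0] by (simp add: I_def[abs_def])
  define F1 F2 F3 F4 G1 G2 where "F1 = I F" and "F2 = I F1" and "F3 = I F2" and "F4 = I F3"
    and "G1 = I G" and "G2 = I G1"
  have ad: "antideriv 0 1 F1 F" "antideriv 0 1 F2 F1" "antideriv 0 1 F3 F2" "antideriv 0 1 F4 F3"
    "antideriv 0 1 G1 G" "antideriv 0 1 G2 G1"
    unfolding F1_def F2_def F3_def F4_def G1_def G2_def
    using I F G antideriv_L2_fun by metis+
  have z0: "F1 0 = 0" "F2 0 = 0" "F3 0 = 0" "F4 0 = 0" "G1 0 = 0" "G2 0 = 0"
    by (simp_all add: F1_def F2_def F3_def F4_def G1_def G2_def I_def)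
  have b1: "\<bar>F1 s\<bar> \<le> N" "\<bar>G1 s\<bar> \<le> N" if "s \<in> {0..1}" for s
    using abs_integral_le_l2_norm[OF F that] abs_integral_le_l2_norm[OF G that] nn
    by (simp_all add: F1_def G1_def I_def N_def)
  have b2: "\<bar>F2 s\<bar> \<le> N" "\<bar>G2 s\<bar> \<le> N" if "s \<in> {0..1}" for s
    unfolding F2_def G2_def I_def[of F1] I_def[of G1]
    by (intro abs_integral_le_bound antideriv_continuous[OF ad(1)] antideriv_continuous[OF ad(5)] b1 that; assumption)+
  have b3: "\<bar>F3 s\<bar> \<le> N" if "s \<in> {0..1}" for s
    unfolding F3_def I_def[of F2]
    by (intro abs_integral_le_bound antideriv_continuous[OF ad(2)] b2 that; assumption)
  have b4: "\<bar>F4 s\<bar> \<le> N" if "s \<in> {0..1}" for s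
    unfolding F4_def I_def[of F3]
    by (intro abs_integral_le_bound antideriv_continuous[OF ad(3)] b3 that; assumption)
  have one: "(1::real) \<in> {0..1}" by simp
  obtain \<alpha> \<beta> \<gamma> \<delta> :: real where c:
    "\<bar>\<alpha>\<bar> \<le> 100 * N" "\<bar>\<beta>\<bar> \<le> 100 * N" "\<bar>\<gamma>\<bar> \<le> 100 * N" "\<bar>\<delta>\<bar> \<le> 100 * N"
    and bc: "bc_values a t (\<delta> + t\<^sup>2 * \<alpha>) (t\<^sup>2 * \<beta> + \<gamma>)
       (\<delta> + t\<^sup>2 * (\<alpha> + \<beta> + F2 1) + \<gamma> + G2 1 - \<alpha> / 2 - \<beta> / 6 - F4 1)
       (t\<^sup>2 * (\<beta> + F1 1) + \<gamma> + G1 1 - \<alpha> - \<beta> / 2 - F3 1)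
       \<alpha> \<beta> (\<alpha> + \<beta> + F2 1) (\<beta> + F1 1)"
    using bc_constants[OF t b1(1)[OF one] b2(1)[OF one] b3[OF one] b4[OF one] b1(2)[OF one] b2(2)[OF one]] .
  define W where "W s = (\<alpha> + \<beta> * s) + F2 s" for s
  define W' where "W' s = \<beta> + F1 s" for s
  define z where "z s = t\<^sup>2 * W s + ((\<delta> + \<gamma> * s - \<alpha> / 2 * s\<^sup>2 - \<beta> / 6 * s ^ 3) + (G2 s - F4 s))" for s
  define z' where "z' s = t\<^sup>2 * W' s + ((\<gamma> - \<alpha> * s - \<beta> / 2 * s\<^sup>2) + (G1 s - F3 s))" for s
  have "antideriv 0 1 W W'"
    unfolding W_def W'_def
    by (intro antideriv_add ad antideriv_DERIV continuous_intros) (auto intro!: derivative_eq_intros)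
  \<comment> \<open>The summand 0 is the derivative of the constant \<beta>, kept so that
    \<open>antideriv_add\<close> matches.\<close>
  have "antideriv 0 1 W' (\<lambda>s. 0 + F s)"
    unfolding W'_def by (intro antideriv_add ad antideriv_DERIV continuous_intros) auto
  have W: "h2_rep 0 1 W W W' F"
    using \<open>antideriv 0 1 W W'\<close> \<open>antideriv 0 1 W' (\<lambda>s. 0 + F s)\<close> by (simp add: h2_rep_def)
  have "antideriv 0 1 z z'"
    unfolding z_def[abs_def] z'_def[abs_def]
    by (intro antideriv_add antideriv_diff ad antideriv_cmult \<open>antideriv 0 1 W W'\<close> antideriv_DERIV continuous_intros)
      (auto intro!: derivative_eq_intros simp: power2_eq_square)
  have "antideriv 0 1 z' (\<lambda>s. t\<^sup>2 * (0 + F s) + ((- \<alpha> - \<beta> * s) + (G s - F2 s)))"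
    unfolding z'_def[abs_def]
    by (intro antideriv_add antideriv_diff ad antideriv_cmult \<open>antideriv 0 1 W' (\<lambda>s. 0 + F s)\<close> antideriv_DERIV continuous_intros)
      (auto intro!: derivative_eq_intros)
  moreover have "(\<lambda>s. t\<^sup>2 * (0 + F s) + ((- \<alpha> - \<beta> * s) + (G s - F2 s))) = (\<lambda>s. t\<^sup>2 * F s + G s - W s)"
    by (auto simp: W_def)
  ultimately have z: "h2_rep 0 1 z z z' (\<lambda>s. t\<^sup>2 * F s + G s - W s)"
    using \<open>antideriv 0 1 z z'\<close> by (simp add: h2_rep_def)
  have "(z, W) \<in> H2_bc a t"
    unfolding H2_bc_iff[OF z W] using bc by (simp add: z_def z'_def W_def W'_def z0 algebra_simps)
  moreover have "\<bar>z s\<bar> \<le> 500 * N \<and> \<bar>z' s\<bar> \<le> 500 * N \<and> \<bar>W s\<bar> \<le> 500 * N \<and> \<bar>W' s\<bar> \<le> 500 * N"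
    if s: "s \<in> {0..1}" for s
  proof -
    have pw: "\<bar>k * p\<bar> \<le> \<bar>k\<bar>" if "0 \<le> p" "p \<le> 1" for k p :: real
      using that by (simp add: abs_mult mult_left_le)
    have s2: "0 \<le> s\<^sup>2" "s\<^sup>2 \<le> 1" "0 \<le> s ^ 3" "s ^ 3 \<le> 1" "0 \<le> t\<^sup>2" "t\<^sup>2 \<le> 1"
      using s t by (auto simp: power_le_one)
    note p = pw[of s] pw[OF s2(1,2)] pw[OF s2(3,4)] pw[OF s2(5,6)]
    have W: "\<bar>W s\<bar> \<le> 201 * N"
      unfolding W_def using p(1)[of \<beta>] s c(1,2) b2(1)[OF s] by simp
    have W': "\<bar>W' s\<bar> \<le> 101 * N" unfolding W'_def using c(2) b1(1)[OF s] by linarith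
    have "\<bar>t\<^sup>2 * W s\<bar> \<le> 201 * N" using p(4)[of "W s"] W by (simp add: mult.commute)
    moreover have "\<bar>\<gamma> * s\<bar> \<le> 100 * N" "\<bar>\<alpha> * s\<bar> \<le> 100 * N"
      using p(1)[of \<gamma>] p(1)[of \<alpha>] s c by auto
    moreover have "\<bar>\<alpha> / 2 * s\<^sup>2\<bar> \<le> 50 * N" "\<bar>\<beta> / 2 * s\<^sup>2\<bar> \<le> 50 * N" "\<bar>\<beta> / 6 * s ^ 3\<bar> \<le> 20 * N"
      using p(2)[of "\<alpha> / 2"] p(2)[of "\<beta> / 2"] p(3)[of "\<beta> / 6"] c(1,2) by linarith+
    moreover have "\<bar>t\<^sup>2 * W' s\<bar> \<le> 101 * N" using p(4)[of "W' s"] W' by (simp add: mult.commute)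
    ultimately have "\<bar>z s\<bar> \<le> 500 * N" "\<bar>z' s\<bar> \<le> 500 * N"
      using c(3,4) b1(2)[OF s] b2(2)[OF s] b3[OF s] b4[OF s] \<open>0 \<le> N\<close>
      unfolding z_def z'_def abs_le_iff by (elim conjE; intro conjI; linarith)+
    then show ?thesis using W W' \<open>0 \<le> N\<close> by linarith
  qed
  ultimately show ?thesis
    using that[of z z' W W'] z W unfolding N_def[symmetric] by blast
qed

text \<open>For conforming pairs the sum over the elements telescopes to K(1) - K(0). At a clamped,
  supported or free end each product in K has a factor that the conditions on one of the two pairs
  annihilate.\<close>

lemma H2_bc_pairing_zero:
  assumes m: "is_mesh n x" and uM: "(u, M) \<in> H2_bc a t" and zW: "(z, W) \<in> H2_bc a t"
  shows "trace_pairing t n x (trace2 n x (u, M)) (z, W) = 0"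
proof -
  have H: "u \<in> H2 unit_ivl" "M \<in> H2 unit_ivl" "z \<in> H2 unit_ivl" "W \<in> H2 unit_ivl"
    using uM zW by (auto simp: H2_bc_def)
  obtain v v' v'' where v: "h2_rep 0 1 u v v' v''" using H H2_Ioo_iff[of 0 1 u] by auto
  obtain N N' N'' where N: "h2_rep 0 1 M N N' N''" using H H2_Ioo_iff[of 0 1 M] by auto
  obtain y y' y'' where y: "h2_rep 0 1 z y y' y''" using H H2_Ioo_iff[of 0 1 z] by auto
  obtain w w' w'' where w: "h2_rep 0 1 W w w' w''" using H H2_Ioo_iff[of 0 1 W] by auto
  define K where "K s = - (v s * w' s) + N' s * y s - N s * (y' s - t\<^sup>2 * w' s) + (v' s - t\<^sup>2 * N' s) * w s" for s
  have "trace_pairing t n x (trace2 n x (u, M)) (z, W) =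
    (\<Sum>j = 1..n. elem_pairing t (trace_elem x j u) (trace_elem x j M) (trace_elem x j z) (trace_elem x j W))"
    using H H2_unit_imp_H2_mesh[OF m] by (intro trace_pairing_eq[OF m]) (auto simp: test_space_def)
  also have "\<dots> = (\<Sum>j = 1..n. K (x j) - K (x (j - 1)))"
  proof (rule sum.cong[OF refl])
    fix j assume j: "j \<in> {1..n}"
    note b = mesh_elem_bounds[OF m j]
    note t = trace_elem_eq[OF b(2) h2_rep_subinterval[OF _ b]]
    show "elem_pairing t (trace_elem x j u) (trace_elem x j M) (trace_elem x j z) (trace_elem x j W) = K (x j) - K (x (j - 1))"
      unfolding t[OF v] t[OF N] t[OF y] t[OF w] by (simp add: K_def)
  qed
  also have "\<dots> = K 1 - K 0" by (rule mesh_telescope[OF m])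
  also have "\<dots> = 0"
    using uM zW unfolding H2_bc_iff[OF v N] H2_bc_iff[OF y w]
    by (cases a) (auto simp: bc_values_def K_def)
  finally show ?thesis .
qed

subsection \<open>Elementwise Green formula\<close>

text \<open>Moves all derivatives from (z,W) to (u,M): the boundary terms of Green's formula are
  exactly the trace pairing, and the strong operators remain on the right.\<close>

lemma elem_green:
  assumes m: "is_mesh n x" and j: "j \<in> {1..n}"
    and u: "h2_rep 0 1 u v v' v''" and M: "h2_rep 0 1 M N N' N''"
    and z: "z \<in> H2 (elem x j)" and W: "W \<in> H2 (elem x j)"
  shows "l2_inner (elem x j) u (wderiv 2 (elem x j) W)
    + l2_inner (elem x j) M (\<lambda>s. W s + wderiv 2 (elem x j) z s - t\<^sup>2 * wderiv 2 (elem x j) W s)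
    + elem_pairing t (trace_elem x j u) (trace_elem x j M) (trace_elem x j z) (trace_elem x j W)
    = l2_inner (elem x j) (\<lambda>s. v'' s + N s - t\<^sup>2 * N'' s) W + l2_inner (elem x j) N'' z"
proof -
  let ?J = "elem x j"
  note b = mesh_elem_bounds[OF m j]
  have J: "?J = {x (j - 1)<..<x j}" by (simp add: elem_def)
  note u' = h2_rep_subinterval[OF u b] and M' = h2_rep_subinterval[OF M b]
  obtain y y' y'' where y: "h2_rep (x (j - 1)) (x j) z y y' y''" using H2_elem_rep[OF m j z] .
  obtain w w' w'' where w: "h2_rep (x (j - 1)) (x j) W w w' w''" using H2_elem_rep[OF m j W] .
  note rep = h2_repD(1,4-6)[OF u', folded J] h2_repD(1,4-6)[OF M', folded J]
    h2_repD(1,4-6)[OF y, folded J] h2_repD(1,4-6)[OF w, folded J]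
  note w2 = h2_rep_wderiv(2)[OF b(2) w, folded J] and y2 = h2_rep_wderiv(2)[OF b(2) y, folded J]
  have 1: "l2_inner ?J u (wderiv 2 ?J W) = l2_inner ?J v w''"
    by (rule l2_inner_cong[symmetric]) (auto intro: rep w2)
  have "ae_eq ?J (\<lambda>s. w s + y'' s - t\<^sup>2 * w'' s) (\<lambda>s. W s + wderiv 2 ?J z s - t\<^sup>2 * wderiv 2 ?J W s)"
    by (intro ae_eq_diff ae_eq_add ae_eq_cmult rep w2 y2)
  then have 2: "l2_inner ?J M (\<lambda>s. W s + wderiv 2 ?J z s - t\<^sup>2 * wderiv 2 ?J W s)
    = l2_inner ?J N (\<lambda>s. w s + y'' s - t\<^sup>2 * w'' s)"
    using rep by (intro l2_inner_cong[symmetric] L2_diff L2_add L2_cmult) auto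
  have 3: "l2_inner ?J (\<lambda>s. v'' s + N s - t\<^sup>2 * N'' s) W = l2_inner ?J (\<lambda>s. v'' s + N s - t\<^sup>2 * N'' s) w"
    using rep by (intro l2_inner_cong[symmetric] L2_diff L2_add L2_cmult) auto
  have 4: "l2_inner ?J N'' z = l2_inner ?J N'' y"
    using rep by (intro l2_inner_cong[symmetric]) auto
  have ab: "x (j - 1) \<le> x j" using b(2) by simp
  note g = h2_rep_green[OF ab u' w, folded J] h2_rep_green[OF ab M' y, folded J] h2_rep_green[OF ab M' w, folded J]
  have "l2_inner ?J N (\<lambda>s. w s + y'' s - t\<^sup>2 * w'' s) = l2_inner ?J N w + l2_inner ?J N y'' - t\<^sup>2 * l2_inner ?J N w''"
    using rep by (simp add: l2_inner_diff_right l2_inner_add_right l2_inner_cmult_right L2_add L2_cmult)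
  moreover have "l2_inner ?J (\<lambda>s. v'' s + N s - t\<^sup>2 * N'' s) w = l2_inner ?J v'' w + l2_inner ?J N w - t\<^sup>2 * l2_inner ?J N'' w"
    using rep by (simp add: l2_inner_diff_left l2_inner_add_left l2_inner_cmult_left L2_add L2_cmult)
  \<comment> \<open>Green's identity for (M,W) is multiplied by t^2 beforehand, so that the
    conclusion is linear in the facts at hand.\<close>
  moreover have "t\<^sup>2 * (l2_inner ?J N w'' - l2_inner ?J N'' w) =
    t\<^sup>2 * ((N (x j) * w' (x j) - N (x (j - 1)) * w' (x (j - 1))) - (N' (x j) * w (x j) - N' (x (j - 1)) * w (x (j - 1))))"
    using g(3) by simp
  ultimately show ?thesis
    unfolding 1 2 3 4 trace_elem_eq[of x j, OF b(2) u'] trace_elem_eq[of x j, OF b(2) M']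
      trace_elem_eq[of x j, OF b(2) y] trace_elem_eq[of x j, OF b(2) w] elem_pairing.simps
    using g(1,2) by (simp add: algebra_simps)
qed

subsection \<open>Uniqueness\<close>

text \<open>Only the weak form is available for the two solutions, so their difference is tested
  rather than differentiated.\<close>

lemma solves_L2_part_unique:
  assumes m: "is_mesh n x" and t: "t \<in> {0..1}"
    and 1: "solves a t n x f (u1, M1, q1)" and 2: "solves a t n x f (u2, M2, q2)"
  shows "ae_eq unit_ivl u1 u2" "ae_eq unit_ivl M1 M2"
proof -
  have L: "u1 \<in> L2 unit_ivl" "M1 \<in> L2 unit_ivl" "u2 \<in> L2 unit_ivl" "M2 \<in> L2 unit_ivl"
    and q: "q1 \<in> trace_space a t n x" "q2 \<in> trace_space a t n x"
    using 1 2 by (auto simp: solves_def trial_space_def)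
  define F where "F s = u1 s - u2 s" for s
  define G where "G s = M1 s - M2 s" for s
  have FL: "F \<in> L2 unit_ivl" and GL: "G \<in> L2 unit_ivl"
    unfolding F_def G_def by (intro L2_diff L)+
  obtain z z' W W' where z: "h2_rep 0 1 z z z' (\<lambda>s. t\<^sup>2 * F s + G s - W s)"
    and W: "h2_rep 0 1 W W W' F" and zW: "(z, W) \<in> H2_bc a t"
    using bvp_exists[OF t FL GL] by metis
  have H: "z \<in> H2 unit_ivl" "W \<in> H2 unit_ivl" using zW by (auto simp: H2_bc_def)
  have ts: "(z, W) \<in> test_space n x"
    using H H2_unit_imp_H2_mesh[OF m] by (simp add: test_space_def)
  \<comment> \<open>W'' = F and W + z'' - t^2 W'' = G turn the volume terms into inner products with
    F and G; taking the difference of the two solutions then gives |F|^2 + |G|^2 = 0 in L_2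
    norms.\<close>
  have form: "bform t n x (u, M, q) (z, W) = l2_inner unit_ivl u F + l2_inner unit_ivl M G"
    if L: "u \<in> L2 unit_ivl" "M \<in> L2 unit_ivl" and q: "q \<in> trace_space a t n x" for u M q
  proof -
    obtain u' M' where "(u', M') \<in> H2_bc a t" "q = trace2 n x (u', M')"
      using q by (auto simp: trace_space_def)
    then have "trace_pairing t n x q (z, W) = 0" using H2_bc_pairing_zero[OF m _ zW] by simp
    moreover have "l2_inner (elem x j) u (wderiv 2 (elem x j) W) = l2_inner (elem x j) u F"
      "l2_inner (elem x j) M (\<lambda>s. W s + wderiv 2 (elem x j) z s - t\<^sup>2 * wderiv 2 (elem x j) W s)
        = l2_inner (elem x j) M G" if j: "j \<in> {1..n}" for j
    proof -
      note b = mesh_elem_bounds[OF m j]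
      note sub = elem_subset_unit[OF m j]
      have L': "u \<in> L2 (elem x j)" "M \<in> L2 (elem x j)" "F \<in> L2 (elem x j)" "G \<in> L2 (elem x j)"
        using L FL GL sub by (auto intro: L2_subset)
      have d: "ae_eq (elem x j) F (wderiv 2 (elem x j) W)"
        "ae_eq (elem x j) (\<lambda>s. t\<^sup>2 * F s + G s - W s) (wderiv 2 (elem x j) z)"
        using h2_rep_wderiv(2)[OF b(2) h2_rep_subinterval[OF W b]]
          h2_rep_wderiv(2)[OF b(2) h2_rep_subinterval[OF z b]] by (simp_all add: elem_def)
      show "l2_inner (elem x j) u (wderiv 2 (elem x j) W) = l2_inner (elem x j) u F"
        by (rule l2_inner_cong[symmetric]) (use L' d in auto)
      have "ae_eq (elem x j) G (\<lambda>s. W s + wderiv 2 (elem x j) z s - t\<^sup>2 * wderiv 2 (elem x j) W s)"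
        using d unfolding ae_eq_def by eventually_elim (simp add: algebra_simps)
      then show "l2_inner (elem x j) M (\<lambda>s. W s + wderiv 2 (elem x j) z s - t\<^sup>2 * wderiv 2 (elem x j) W s)
        = l2_inner (elem x j) M G"
        by (intro l2_inner_cong[symmetric]) (use L' in auto)
    qed
    ultimately show ?thesis
      using sum_l2_inner_elem[OF m L(1) FL] sum_l2_inner_elem[OF m L(2) GL] by (simp add: bform_def)
  qed
  have "bform t n x (u1, M1, q1) (z, W) = bform t n x (u2, M2, q2) (z, W)"
    using 1 2 ts by (simp add: solves_def)
  then have "l2_inner unit_ivl F F + l2_inner unit_ivl G G = 0"
    unfolding form[OF L(1,2) q(1)] form[OF L(3,4) q(2)]
    using l2_inner_diff_left[OF L(1,3) FL] l2_inner_diff_left[OF L(2,4) GL]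
    by (simp add: F_def[abs_def] G_def[abs_def])
  then have "l2_inner unit_ivl F F = 0" "l2_inner unit_ivl G G = 0"
    using l2_inner_nonneg[of unit_ivl F] l2_inner_nonneg[of unit_ivl G] by linarith+
  then have "ae_eq unit_ivl F (\<lambda>s. 0)" "ae_eq unit_ivl G (\<lambda>s. 0)"
    using l2_inner_self_eq_0 FL GL by blast+
  then show "ae_eq unit_ivl u1 u2" "ae_eq unit_ivl M1 M2"
    by (auto simp: ae_eq_def F_def G_def)
qed

text \<open>The cubic Hermite interpolant of \<open>c\<close>, extended by zero to the other elements.\<close>

lemma H2_mesh_with_elem_trace:
  assumes m: "is_mesh n x" and j: "j \<in> {1..n}"
  obtains z where "z \<in> H2_mesh n x" "trace_elem x j z = c"
    "\<And>i. i \<in> {1..n} \<Longrightarrow> i \<noteq> j \<Longrightarrow> trace_elem x i z = (0, 0, 0, 0)"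
proof -
  obtain c0 d0 c1 d1 where c: "c = (c0, d0, c1, d1)" by (cases c)
  note b = mesh_elem_bounds[OF m j]
  define A where "A = x (j - 1)"
  define h where "h = x j - x (j - 1)"
  have h: "h > 0" using b by (simp add: h_def)
  \<comment> \<open>k2 and k3 solve p = c1 and p' = d1 at the right node; value and slope at the
    left node are the lower coefficients.\<close>
  define k2 where "k2 = 3 * (c1 - c0) / h\<^sup>2 - (2 * d0 + d1) / h"
  define k3 where "k3 = (d0 + d1) / h\<^sup>2 - 2 * (c1 - c0) / h ^ 3"
  define p where "p s = c0 + d0 * (s - A) + k2 * (s - A)\<^sup>2 + k3 * (s - A) ^ 3" for s
  define p' where "p' s = d0 + 2 * k2 * (s - A) + 3 * k3 * (s - A)\<^sup>2" for s
  define p'' where "p'' s = 2 * k2 + 6 * k3 * (s - A)" for s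
  have pp: "antideriv a b p p'" "antideriv a b p' p''" for a b
    by (intro antideriv_DERIV;
        (auto simp: p_def[abs_def] p'_def[abs_def] p''_def[abs_def] power2_eq_square
          intro!: derivative_eq_intros continuous_intros))+
  define z where "z s = (if s \<in> elem x j then p s else 0)" for s
  have zj: "h2_rep (x (j - 1)) (x j) z p p' p''"
    unfolding h2_rep_def using pp
    by (auto simp: ae_eq_def z_def elem_def intro!: AE_I2)
  have zi: "h2_rep (x (i - 1)) (x i) z (\<lambda>_. 0) (\<lambda>_. 0) (\<lambda>_. 0)" if i: "i \<in> {1..n}" "i \<noteq> j" for i
  proof -
    have "x i \<le> x (j - 1) \<or> x j \<le> x (i - 1)"
    proof (cases "i < j")
      case True
      then show ?thesis using mesh_mono[OF m, of i "j - 1"] j by simp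
    next
      case False
      then show ?thesis using mesh_mono[OF m, of j "i - 1"] i by simp
    qed
    then have "z s = 0" if "s \<in> {x (i - 1)<..<x i}" for s
      using that by (auto simp: z_def elem_def)
    moreover have "antideriv (x (i - 1)) (x i) (\<lambda>_. 0) (\<lambda>_. 0)"
      by (intro antideriv_DERIV) auto
    ultimately show ?thesis by (auto simp: h2_rep_def ae_eq_def intro!: AE_I2)
  qed
  have "z \<in> L2 unit_ivl"
  proof -
    have "continuous_on {0..1} p" using antideriv_continuous[OF pp(1)] .
    then have "p \<in> L2 unit_ivl" by (rule L2_continuous)
    moreover have "elem x j \<inter> space lebesgue \<in> sets lebesgue" by simp
    then have "(\<lambda>s. indicator (elem x j) s :: real) \<in> borel_measurable (lebesgue_on unit_ivl)"
      by (intro measurable_restrict_space1 borel_measurable_indicator) simp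
    ultimately have meas: "(\<lambda>s. indicator (elem x j) s * p s) \<in> borel_measurable (lebesgue_on unit_ivl)"
      by (auto intro: borel_measurable_times L2_measurable)
    have "integrable (lebesgue_on unit_ivl) (\<lambda>s. (indicator (elem x j) s * p s)\<^sup>2)"
    proof (rule Bochner_Integration.integrable_bound)
      show "integrable (lebesgue_on unit_ivl) (\<lambda>s. (p s)\<^sup>2)" using \<open>p \<in> L2 unit_ivl\<close> by (simp add: L2_def)
    qed (use meas in \<open>auto simp: indicator_def intro!: borel_measurable_power\<close>)
    with meas have "(\<lambda>s. indicator (elem x j) s * p s) \<in> L2 unit_ivl" by (simp add: L2_def)
    moreover have "(\<lambda>s. indicator (elem x j) s * p s) = z" by (auto simp: z_def indicator_def)
    ultimately show ?thesis by simp
  qed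
  moreover have "z \<in> H2 (elem x i)" if i: "i \<in> {1..n}" for i
    using H2_Ioo_iff[OF mesh_less[OF m i]] zj zi[OF i] by (cases "i = j") (auto simp: elem_def)
  ultimately have "z \<in> H2_mesh n x" by (simp add: H2_mesh_def)
  moreover have "trace_elem x j z = c"
  proof -
    have xj: "x j - A = h" "x (j - 1) - A = 0" by (simp_all add: A_def h_def)
    have "k2 * h\<^sup>2 = 3 * (c1 - c0) - (2 * d0 + d1) * h" "k3 * h ^ 3 = (d0 + d1) * h - 2 * (c1 - c0)"
      using h by (simp_all add: k2_def k3_def field_simps power2_eq_square power3_eq_cube)
    then have "p (x j) = c1" unfolding p_def xj by (simp add: algebra_simps)
    \<comment> \<open>Naming the difference quotient makes the slope condition linear.\<close>
    moreover define r where "r = (c1 - c0) / h"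
    have "k2 * h = 3 * r - (2 * d0 + d1)" "k3 * h\<^sup>2 = (d0 + d1) - 2 * r"
      using h by (simp_all add: r_def k2_def k3_def field_simps power2_eq_square power3_eq_cube)
    then have "p' (x j) = d1" unfolding p'_def xj by (simp add: mult.assoc)
    ultimately show ?thesis
      unfolding trace_elem_eq[of x j, OF b(2) zj] c by (simp add: p_def p'_def A_def)
  qed
  moreover have "trace_elem x i z = (0, 0, 0, 0)" if "i \<in> {1..n}" "i \<noteq> j" for i
    using trace_elem_eq[of x i, OF mesh_less[OF m that(1)] zi[OF that]] .
  ultimately show ?thesis using that by blast
qed

text \<open>The entries of z meet only those of M, so unit vectors in z determine M. With M settled,
  unit vectors in W determine u.\<close>

lemma elem_pairing_separates:
  assumes "\<And>z W. elem_pairing t U M z W = elem_pairing t U' M' z W"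
  shows "U = U'" "M = M'"
proof -
  obtain u0 du0 u1 du1 where U: "U = (u0, du0, u1, du1)" by (cases U)
  obtain u0' du0' u1' du1' where U': "U' = (u0', du0', u1', du1')" by (cases U')
  obtain m0 dm0 m1 dm1 where M: "M = (m0, dm0, m1, dm1)" by (cases M)
  obtain m0' dm0' m1' dm1' where M': "M' = (m0', dm0', m1', dm1')" by (cases M')
  note a = assms[unfolded U U' M M']
  have *: "m0 = m0'" "dm0 = dm0'" "m1 = m1'" "dm1 = dm1'"
    using a[of "(1, 0, 0, 0)" "(0, 0, 0, 0)"] a[of "(0, 1, 0, 0)" "(0, 0, 0, 0)"]
      a[of "(0, 0, 1, 0)" "(0, 0, 0, 0)"] a[of "(0, 0, 0, 1)" "(0, 0, 0, 0)"] by auto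
  have "u0 = u0'" "du0 = du0'" "u1 = u1'" "du1 = du1'"
    using a[of "(0, 0, 0, 0)" "(1, 0, 0, 0)"] a[of "(0, 0, 0, 0)" "(0, 1, 0, 0)"]
      a[of "(0, 0, 0, 0)" "(0, 0, 1, 0)"] a[of "(0, 0, 0, 0)" "(0, 0, 0, 1)"] by (auto simp: *)
  with * show "U = U'" "M = M'" by (simp_all add: U U' M M')
qed

text \<open>Comes after uniqueness of the L_2 parts: the volume terms then agree, and what remains
  is equality of the two trace pairings on all of the broken test space, where each element can be
  tested alone.\<close>

lemma solves_trace_unique:
  assumes m: "is_mesh n x" and t: "t \<in> {0..1}"
    and 1: "solves a t n x f (u1, M1, q1)" and 2: "solves a t n x f (u2, M2, q2)"
  shows "q1 = q2"
proof -
  have L: "u1 \<in> L2 unit_ivl" "M1 \<in> L2 unit_ivl"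
    and q: "q1 \<in> trace_space a t n x" "q2 \<in> trace_space a t n x"
    using 1 2 by (auto simp: solves_def trial_space_def)
  obtain v1 N1 where v1: "(v1, N1) \<in> H2_bc a t" "q1 = trace2 n x (v1, N1)"
    using q(1) by (auto simp: trace_space_def)
  obtain v2 N2 where v2: "(v2, N2) \<in> H2_bc a t" "q2 = trace2 n x (v2, N2)"
    using q(2) by (auto simp: trace_space_def)
  have H: "v1 \<in> H2 unit_ivl" "N1 \<in> H2 unit_ivl" "v2 \<in> H2 unit_ivl" "N2 \<in> H2 unit_ivl"
    using v1 v2 by (auto simp: H2_bc_def)
  have tp: "trace_pairing t n x q1 (z, W) = trace_pairing t n x q2 (z, W)" if ts: "(z, W) \<in> test_space n x" for z W
  proof -
    have "l2_inner (elem x j) u1 (wderiv 2 (elem x j) W) = l2_inner (elem x j) u2 (wderiv 2 (elem x j) W)"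
      "l2_inner (elem x j) M1 (\<lambda>s. W s + wderiv 2 (elem x j) z s - t\<^sup>2 * wderiv 2 (elem x j) W s)
        = l2_inner (elem x j) M2 (\<lambda>s. W s + wderiv 2 (elem x j) z s - t\<^sup>2 * wderiv 2 (elem x j) W s)"
      if j: "j \<in> {1..n}" for j
    proof -
      note sub = elem_subset_unit[OF m j]
      have L': "u1 \<in> L2 (elem x j)" "M1 \<in> L2 (elem x j)"
        using L sub by (auto intro: L2_subset)
      have ae: "ae_eq (elem x j) u1 u2" "ae_eq (elem x j) M1 M2"
        using solves_L2_part_unique[OF m t 1 2] sub by (auto intro: ae_eq_subset)
      have zW: "z \<in> H2 (elem x j)" "W \<in> H2 (elem x j)"
        using ts j by (auto simp: test_space_def H2_mesh_def)
      have d2: "wderiv 2 (elem x j) g \<in> L2 (elem x j)" "g \<in> L2 (elem x j)" if g: "g \<in> H2 (elem x j)" for g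
      proof -
        obtain w w' w'' where w: "h2_rep (x (j - 1)) (x j) g w w' w''" using H2_elem_rep[OF m j g] .
        show "wderiv 2 (elem x j) g \<in> L2 (elem x j)" "g \<in> L2 (elem x j)"
          using L2_ae_eq[OF h2_repD(6)[OF w] h2_rep_wderiv(2)[OF mesh_less[OF m j] w]] g
          by (simp_all add: elem_def H2_def)
      qed
      show "l2_inner (elem x j) u1 (wderiv 2 (elem x j) W) = l2_inner (elem x j) u2 (wderiv 2 (elem x j) W)"
        by (intro l2_inner_cong ae ae_eq_refl L' d2 zW elem_measurable)
      show "l2_inner (elem x j) M1 (\<lambda>s. W s + wderiv 2 (elem x j) z s - t\<^sup>2 * wderiv 2 (elem x j) W s)
        = l2_inner (elem x j) M2 (\<lambda>s. W s + wderiv 2 (elem x j) z s - t\<^sup>2 * wderiv 2 (elem x j) W s)"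
        by (intro l2_inner_cong ae ae_eq_refl L' L2_diff L2_add L2_cmult d2 zW elem_measurable)
    qed
    moreover have "bform t n x (u1, M1, q1) (z, W) = bform t n x (u2, M2, q2) (z, W)"
      using 1 2 ts by (simp add: solves_def)
    ultimately show ?thesis by (simp add: bform_def)
  qed
  have eq: "trace_elem x j v1 = trace_elem x j v2 \<and> trace_elem x j N1 = trace_elem x j N2" if j: "j \<in> {1..n}" for j
  proof -
    have "elem_pairing t (trace_elem x j v1) (trace_elem x j N1) c d
      = elem_pairing t (trace_elem x j v2) (trace_elem x j N2) c d" for c d
    proof -
      obtain z where z: "z \<in> H2_mesh n x" "trace_elem x j z = c"
        "\<And>i. i \<in> {1..n} \<Longrightarrow> i \<noteq> j \<Longrightarrow> trace_elem x i z = (0, 0, 0, 0)"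
        using H2_mesh_with_elem_trace[OF m j, of c] by metis
      obtain W where W: "W \<in> H2_mesh n x" "trace_elem x j W = d"
        "\<And>i. i \<in> {1..n} \<Longrightarrow> i \<noteq> j \<Longrightarrow> trace_elem x i W = (0, 0, 0, 0)"
        using H2_mesh_with_elem_trace[OF m j, of d] by metis
      have ts: "(z, W) \<in> test_space n x" using z W by (simp add: test_space_def)
      have zero: "elem_pairing t A B (0, 0, 0, 0) (0, 0, 0, 0) = 0" for A B
        by (cases A; cases B) simp
      have "trace_pairing t n x (trace2 n x (u, M)) (z, W) = elem_pairing t (trace_elem x j u) (trace_elem x j M) c d"
        if "u \<in> H2 unit_ivl" "M \<in> H2 unit_ivl" for u M
      proof -
        have "trace_pairing t n x (trace2 n x (u, M)) (z, W) = (\<Sum>i = 1..n.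
            elem_pairing t (trace_elem x i u) (trace_elem x i M) (trace_elem x i z) (trace_elem x i W))"
          by (rule trace_pairing_eq[OF m that ts])
        also have "\<dots> = (\<Sum>i = 1..n. if i = j then elem_pairing t (trace_elem x j u) (trace_elem x j M) c d else 0)"
          using z W by (intro sum.cong) (auto simp: zero)
        also have "\<dots> = elem_pairing t (trace_elem x j u) (trace_elem x j M) c d" using j by simp
        finally show ?thesis .
      qed
      then show ?thesis using tp[OF ts] H unfolding v1(2) v2(2) by simp
    qed
    from elem_pairing_separates[OF this] show ?thesis by simp
  qed
  \<comment> \<open>Traces are extensional on {1..n}, so agreement on the elements is equality of
    functions.\<close>
  show ?thesis
    unfolding v1(2) v2(2) trace2_def trace1_def prod.case using eq by (auto simp: restrict_def)
qed

subsection \<open>The trace norm\<close>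

lemma vector_4:
  "(vector [w, x, y, z] :: 'a::zero ^ 4) $ 1 = w"
  "(vector [w, x, y, z] :: 'a::zero ^ 4) $ 2 = x"
  "(vector [w, x, y, z] :: 'a::zero ^ 4) $ 3 = y"
  "(vector [w, x, y, z] :: 'a::zero ^ 4) $ 4 = z"
  unfolding vector_def by simp_all

text \<open>The stiffness part as two squares: d1 - d0 is the integral of v'', and v1 - v0 - h (d0 +
  d1)/2 is its first moment against the midpoint-centred linear function, of squared norm h^3/12. So
  B measures the projection of v'' onto linear polynomials.\<close>

lemma elem_trace_norm_sq_eq:
  assumes "h \<noteq> 0"
  shows "elem_trace_norm_sq h (v0, d0, v1, d1) =
    h / 420 * (156 * v0\<^sup>2 + 108 * (v0 * v1) + 156 * v1\<^sup>2 + 44 * h * (v0 * d0) - 26 * h * (v0 * d1)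
      + 26 * h * (v1 * d0) - 44 * h * (v1 * d1) + 4 * h\<^sup>2 * d0\<^sup>2 - 6 * h\<^sup>2 * (d0 * d1) + 4 * h\<^sup>2 * d1\<^sup>2)
    + ((d1 - d0)\<^sup>2 / h + 12 * (v1 - v0 - h * (d0 + d1) / 2)\<^sup>2 / h ^ 3)"
proof -
  have "elem_trace_norm_sq h (v0, d0, v1, d1) =
    h / 420 * (156 * v0\<^sup>2 + 108 * (v0 * v1) + 156 * v1\<^sup>2 + 44 * h * (v0 * d0) - 26 * h * (v0 * d1)
      + 26 * h * (v1 * d0) - 44 * h * (v1 * d1) + 4 * h\<^sup>2 * d0\<^sup>2 - 6 * h\<^sup>2 * (d0 * d1) + 4 * h\<^sup>2 * d1\<^sup>2)
    + 2 / h ^ 3 * (6 * v0\<^sup>2 - 12 * (v0 * v1) + 6 * v1\<^sup>2 + 6 * h * ((v0 - v1) * (d0 + d1))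
      + 2 * h\<^sup>2 * (d0\<^sup>2 + d1\<^sup>2 + d0 * d1))"
    unfolding elem_trace_norm_sq_def prod.case Let_def matrix_vector_mult_add_rdistrib inner_add_right
      mass_matrix_def stiffness_matrix_def scaleR_matrix_vector_assoc[symmetric] inner_scaleR_right
    by (simp add: matrix_vector_mult_def inner_vec_def sum_4 vector_4 power2_eq_square algebra_simps)
  also have "2 / h ^ 3 * (6 * v0\<^sup>2 - 12 * (v0 * v1) + 6 * v1\<^sup>2 + 6 * h * ((v0 - v1) * (d0 + d1))
      + 2 * h\<^sup>2 * (d0\<^sup>2 + d1\<^sup>2 + d0 * d1)) = (d1 - d0)\<^sup>2 / h + 12 * (v1 - v0 - h * (d0 + d1) / 2)\<^sup>2 / h ^ 3"
    using assms by (simp add: field_simps power2_eq_square power3_eq_cube)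
  finally show ?thesis .
qed

text \<open>For h at most 1 every product is bounded by S^2, and the absolute coefficients add up to
  574, rounded up to 840 = 2 * 420. The factor h is kept because it is what sums to 1 over the
  mesh.\<close>

lemma mass_form_bound:
  fixes h S :: real
  assumes h: "0 < h" "h \<le> 1" and b: "\<bar>v0\<bar> \<le> S" "\<bar>d0\<bar> \<le> S" "\<bar>v1\<bar> \<le> S" "\<bar>d1\<bar> \<le> S"
  shows "h / 420 * (156 * v0\<^sup>2 + 108 * (v0 * v1) + 156 * v1\<^sup>2 + 44 * h * (v0 * d0) - 26 * h * (v0 * d1)
      + 26 * h * (v1 * d0) - 44 * h * (v1 * d1) + 4 * h\<^sup>2 * d0\<^sup>2 - 6 * h\<^sup>2 * (d0 * d1) + 4 * h\<^sup>2 * d1\<^sup>2)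
    \<le> 2 * h * S\<^sup>2"
proof -
  have S: "0 \<le> S" using b by linarith
  have p: "\<bar>r * s\<bar> \<le> S\<^sup>2" if "\<bar>r\<bar> \<le> S" "\<bar>s\<bar> \<le> S" for r s
    unfolding abs_mult power2_eq_square using that S by (intro mult_mono) auto
  have hk: "\<bar>k * r\<bar> \<le> S\<^sup>2" if "\<bar>r\<bar> \<le> S\<^sup>2" "0 \<le> k" "k \<le> 1" for k r :: real
  proof -
    have "\<bar>k * r\<bar> \<le> 1 * \<bar>r\<bar>" unfolding abs_mult using that by (intro mult_right_mono) auto
    then show ?thesis using that(1) by linarith
  qed
  have h2: "0 \<le> h\<^sup>2" "h\<^sup>2 \<le> 1" using h by (auto simp: power_le_one)
  have t: "v0\<^sup>2 \<le> S\<^sup>2" "v1\<^sup>2 \<le> S\<^sup>2" "v0 * v1 \<le> S\<^sup>2" "h * (v0 * d0) \<le> S\<^sup>2" "- (h * (v0 * d1)) \<le> S\<^sup>2"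
    "h * (v1 * d0) \<le> S\<^sup>2" "- (h * (v1 * d1)) \<le> S\<^sup>2" "h\<^sup>2 * d0\<^sup>2 \<le> S\<^sup>2" "- (h\<^sup>2 * (d0 * d1)) \<le> S\<^sup>2" "h\<^sup>2 * d1\<^sup>2 \<le> S\<^sup>2"
    using p[OF b(1,1)] p[OF b(3,3)] p[OF b(1,3)] hk[OF p[OF b(1,2)], of h] hk[OF p[OF b(1,4)], of h]
      hk[OF p[OF b(3,2)], of h] hk[OF p[OF b(3,4)], of h] hk[OF p[OF b(2,2)] h2] hk[OF p[OF b(2,4)] h2]
      hk[OF p[OF b(4,4)] h2] h
    unfolding power2_eq_square[of v0] power2_eq_square[of v1] power2_eq_square[of d0] power2_eq_square[of d1]
    by (simp_all only: abs_le_iff less_imp_le)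
  have "156 * v0\<^sup>2 + 108 * (v0 * v1) + 156 * v1\<^sup>2 + 44 * h * (v0 * d0) - 26 * h * (v0 * d1)
      + 26 * h * (v1 * d0) - 44 * h * (v1 * d1) + 4 * h\<^sup>2 * d0\<^sup>2 - 6 * h\<^sup>2 * (d0 * d1) + 4 * h\<^sup>2 * d1\<^sup>2 \<le> 840 * S\<^sup>2"
    (is "?e \<le> _")
    using t zero_le_power2[of S] unfolding mult.assoc by linarith
  then have "h / 420 * ?e \<le> h / 420 * (840 * S\<^sup>2)"
    using h by (intro mult_left_mono) auto
  then show ?thesis by simp
qed

lemma elem_trace_norm_sq_le:
  assumes "a < b" "b - a \<le> 1" and r: "h2_rep a b u v v' v''"
    and bd: "\<And>s. s \<in> {a..b} \<Longrightarrow> \<bar>v s\<bar> \<le> S" "\<And>s. s \<in> {a..b} \<Longrightarrow> \<bar>v' s\<bar> \<le> S"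
  shows "elem_trace_norm_sq (b - a) (v a, v' a, v b, v' b)
    \<le> 2 * (b - a) * S\<^sup>2 + 4 * l2_inner {a<..<b} v'' v''"
proof -
  let ?J = "{a<..<b}"
  define h where "h = b - a"
  have h: "0 < h" "h \<le> 1" using assms by (auto simp: h_def)
  define E where "E = l2_inner ?J v'' v''"
  have E: "0 \<le> E" unfolding E_def by (rule l2_inner_nonneg)
  note v'' = h2_repD(6)[OF r]
  \<comment> \<open>Green's formula with 1 and with q, whose second derivatives vanish, extracts the
    mean and the first moment of v''; Cauchy-Schwarz bounds them by E.\<close>
  define q where "q s = (a + b) / 2 - s" for s
  have one: "h2_rep a b (\<lambda>_. 1) (\<lambda>_. 1) (\<lambda>_. 0) (\<lambda>_. 0)"
    unfolding h2_rep_def by (intro conjI ae_eq_refl antideriv_DERIV) auto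
  have q: "h2_rep a b q q (\<lambda>_. - 1) (\<lambda>_. 0)"
    unfolding h2_rep_def q_def[abs_def]
    by (intro conjI ae_eq_refl antideriv_DERIV) (auto intro!: derivative_eq_intros)
  have "l2_inner ?J v (\<lambda>_. 0) = 0" by (simp add: l2_inner_def)
  then have "v' b - v' a = l2_inner ?J v'' (\<lambda>_. 1)"
    using h2_rep_green[OF less_imp_le[OF assms(1)] r one] by simp
  then have "(v' b - v' a)\<^sup>2 = (l2_inner ?J v'' (\<lambda>_. 1))\<^sup>2" by simp
  also have "\<dots> \<le> E * l2_inner ?J (\<lambda>_. 1) (\<lambda>_. 1)"
    unfolding E_def by (rule l2_Cauchy_Schwarz[OF v'' h2_repD(4)[OF one]])
  also have "\<dots> \<le> E * h"
    using l2_inner_le_of_bounded[OF h2_repD(4)[OF one] less_imp_le[OF assms(1)], of 1] E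
    by (intro mult_left_mono) (auto simp: h_def)
  finally have 1: "(v' b - v' a)\<^sup>2 / h \<le> E" using h by (simp add: field_simps)
  have qb: "\<bar>q s\<bar> \<le> h / 2" if "s \<in> {a..b}" for s
    using that unfolding q_def h_def abs_le_iff by (auto simp: field_simps)
  have "- (v b - v a - h * (v' a + v' b) / 2) = - l2_inner ?J v'' q + 0"
  proof -
    have "l2_inner ?J v (\<lambda>_. 0) = 0" by (simp add: l2_inner_def)
    then show ?thesis
      using h2_rep_green[OF less_imp_le[OF assms(1)] r q] by (simp add: q_def h_def field_simps)
  qed
  then have "v b - v a - h * (v' a + v' b) / 2 = l2_inner ?J v'' q" by linarith
  then have "(v b - v a - h * (v' a + v' b) / 2)\<^sup>2 = (l2_inner ?J v'' q)\<^sup>2" by simp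
  also have "\<dots> \<le> E * l2_inner ?J q q"
    unfolding E_def by (rule l2_Cauchy_Schwarz[OF v'' h2_repD(4)[OF q]])
  \<comment> \<open>The crude bound |q| <= h/2 gives h^3/4 for the squared norm of q, so this square
    contributes 3 E; together with the mean this makes 4 E.\<close>
  also have "\<dots> \<le> E * (h * (h / 2)\<^sup>2)"
    using l2_inner_le_of_bounded[OF h2_repD(4)[OF q] less_imp_le[OF assms(1)] qb] E
    by (intro mult_left_mono) (auto simp: h_def)
  also have "\<dots> = E * h ^ 3 / 4" by (simp add: power2_eq_square power3_eq_cube)
  finally have 2: "12 * (v b - v a - h * (v' a + v' b) / 2)\<^sup>2 / h ^ 3 \<le> 3 * E"
    using h by (simp add: field_simps)
  have ab: "a \<in> {a..b}" "b \<in> {a..b}" using assms(1) by auto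
  have h0: "h \<noteq> 0" using h by simp
  show ?thesis
    unfolding h_def[symmetric] E_def[symmetric] elem_trace_norm_sq_eq[OF h0]
    using mass_form_bound[OF h bd(1)[OF ab(1)] bd(2)[OF ab(1)] bd(1)[OF ab(2)] bd(2)[OF ab(2)]] 1 2
    by linarith
qed

text \<open>The number of elements drops out: the mass bounds carry the lengths, and the energies on
  the elements add up to that on the whole interval.\<close>

lemma sum_elem_trace_norm_sq_le:
  assumes m: "is_mesh n x" and r: "h2_rep 0 1 u v v' v''"
    and bd: "\<And>s. s \<in> {0..1} \<Longrightarrow> \<bar>v s\<bar> \<le> S" "\<And>s. s \<in> {0..1} \<Longrightarrow> \<bar>v' s\<bar> \<le> S"
  shows "(\<Sum>j = 1..n. elem_trace_norm_sq (x j - x (j - 1)) (trace1 n x u j))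
    \<le> 2 * S\<^sup>2 + 4 * l2_inner unit_ivl v'' v''"
proof -
  have "(\<Sum>j = 1..n. elem_trace_norm_sq (x j - x (j - 1)) (trace1 n x u j))
    \<le> (\<Sum>j = 1..n. 2 * S\<^sup>2 * (x j - x (j - 1)) + 4 * l2_inner (elem x j) v'' v'')"
  proof (rule sum_mono)
    fix j assume j: "j \<in> {1..n}"
    note b = mesh_elem_bounds[OF m j]
    note r' = h2_rep_subinterval[OF r b]
    have "trace1 n x u j = (v (x (j - 1)), v' (x (j - 1)), v (x j), v' (x j))"
      using trace_elem_eq[of x j, OF b(2) r'] j by (simp add: trace1_def)
    moreover have "elem_trace_norm_sq (x j - x (j - 1)) (v (x (j - 1)), v' (x (j - 1)), v (x j), v' (x j))
      \<le> 2 * (x j - x (j - 1)) * S\<^sup>2 + 4 * l2_inner {x (j - 1)<..<x j} v'' v''"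
      by (rule elem_trace_norm_sq_le[OF b(2) _ r']) (use b bd in auto)
    ultimately show "elem_trace_norm_sq (x j - x (j - 1)) (trace1 n x u j)
      \<le> 2 * S\<^sup>2 * (x j - x (j - 1)) + 4 * l2_inner (elem x j) v'' v''"
      by (simp add: elem_def algebra_simps)
  qed
  also have "\<dots> = 2 * S\<^sup>2 * (\<Sum>j = 1..n. x j - x (j - 1)) + 4 * (\<Sum>j = 1..n. l2_inner (elem x j) v'' v'')"
    by (simp add: sum.distrib sum_distrib_left)
  also have "\<dots> = 2 * S\<^sup>2 + 4 * l2_inner unit_ivl v'' v''"
    using mesh_telescope[OF m, of "\<lambda>s. s"] sum_l2_inner_elem[OF m h2_repD(6)[OF r] h2_repD(6)[OF r]] by simp
  finally show ?thesis .
qed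

section \<open>Existence and the uniform bound\<close>

theorem theorem1:
  fixes a :: bc
  shows "\<exists>C>0. \<forall>t\<in>{0..1}. \<forall>n x. is_mesh n x \<longrightarrow> (\<forall>f\<in>L2 unit_ivl.
    \<exists>u M q. solves a t n x f (u, M, q) \<and>
      (\<forall>u' M' q'. solves a t n x f (u', M', q') \<longrightarrow>
         ae_eq unit_ivl u' u \<and> ae_eq unit_ivl M' M \<and> q' = q) \<and>
      trial_norm n x (u, M, q) \<le> C * l2_norm unit_ivl f \<and>
      u \<in> H2 unit_ivl \<and> M \<in> H2 unit_ivl \<and>
      ae_eq unit_ivl (\<lambda>s. - wderiv 2 unit_ivl M s) f \<and>
      ae_eq unit_ivl (\<lambda>s. M s - t\<^sup>2 * wderiv 2 unit_ivl M s + wderiv 2 unit_ivl u s) (\<lambda>s. 0) \<and>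
      q = trace2 n x (u, M))"
proof (intro exI[of _ 3000] conjI ballI allI impI)
  show "(0::real) < 3000" by simp
  fix t :: real and n x f
  assume t: "t \<in> {0..1}" and m: "is_mesh n x" and f: "f \<in> L2 unit_ivl"
  define F where "F s = - f s" for s
  have F: "F \<in> L2 unit_ivl" unfolding F_def by (rule L2_uminus[OF f])
  have Z: "(\<lambda>_. 0) \<in> L2 unit_ivl" by (intro L2_continuous continuous_intros)
  have nF: "l2_norm unit_ivl F + l2_norm unit_ivl (\<lambda>_. 0) = l2_norm unit_ivl f"
    by (simp add: l2_norm_def l2_inner_def F_def)
  \<comment> \<open>The factor 500 is that of \<open>bvp_exists\<close>; a trial norm of at most 6 S
    yields 3000.\<close>
  define S where "S = 500 * l2_norm unit_ivl f"
  \<comment> \<open>The 0 inside the second derivative of u is the datum G.\<close>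
  obtain u u' M M' where u: "h2_rep 0 1 u u u' (\<lambda>s. t\<^sup>2 * F s + 0 - M s)"
    and M: "h2_rep 0 1 M M M' F" and bc: "(u, M) \<in> H2_bc a t"
    and bounds: "\<forall>s\<in>{0..1}. \<bar>u s\<bar> \<le> S \<and> \<bar>u' s\<bar> \<le> S \<and> \<bar>M s\<bar> \<le> S \<and> \<bar>M' s\<bar> \<le> S"
    by (rule bvp_exists[OF t F Z, of a, unfolded nF, folded S_def])
  have bd: "\<bar>u s\<bar> \<le> S" "\<bar>u' s\<bar> \<le> S" "\<bar>M s\<bar> \<le> S" "\<bar>M' s\<bar> \<le> S" if "s \<in> {0..1}" for s
    using bounds that by auto
  define q where "q = trace2 n x (u, M)"
  have H: "u \<in> H2 unit_ivl" "M \<in> H2 unit_ivl" using bc by (auto simp: H2_bc_def)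
  note L = h2_repD(4)[OF u] h2_repD(4)[OF M] h2_repD(6)[OF u]
  have sol: "solves a t n x f (u, M, q)"
    unfolding solves_def
  proof (intro conjI ballI)
    show "(u, M, q) \<in> trial_space a t n x"
      using L bc by (auto simp: trial_space_def trace_space_def q_def)
    fix zW assume ts: "zW \<in> test_space n x"
    obtain z W where zW: "zW = (z, W)" by (cases zW)
    have z: "z \<in> L2 unit_ivl" "\<And>j. j \<in> {1..n} \<Longrightarrow> z \<in> H2 (elem x j)" "\<And>j. j \<in> {1..n} \<Longrightarrow> W \<in> H2 (elem x j)"
      using ts by (auto simp: zW test_space_def H2_mesh_def)
    have "bform t n x (u, M, q) (z, W) = (\<Sum>j = 1..n. l2_inner (elem x j) u (wderiv 2 (elem x j) W)
      + l2_inner (elem x j) M (\<lambda>s. W s + wderiv 2 (elem x j) z s - t\<^sup>2 * wderiv 2 (elem x j) W s)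
      + elem_pairing t (trace_elem x j u) (trace_elem x j M) (trace_elem x j z) (trace_elem x j W))"
      unfolding bform_def prod.case q_def trace_pairing_eq[OF m H ts[unfolded zW]] by (simp add: sum.distrib)
    \<comment> \<open>Here u'' = t^2 F - M and M'' = F are inserted; the factor of W cancels
      identically, leaving only the load.\<close>
    also have "\<dots> = (\<Sum>j = 1..n. l2_inner (elem x j) (\<lambda>s. (t\<^sup>2 * F s + 0 - M s) + M s - t\<^sup>2 * F s) W
        + l2_inner (elem x j) F z)"
      by (rule sum.cong[OF refl]) (rule elem_green[OF m _ u M z(2,3)])
    also have "\<dots> = (\<Sum>j = 1..n. l2_inner (elem x j) F z)"
      by (simp add: l2_inner_def)
    also have "\<dots> = l2_inner unit_ivl F z" by (rule sum_l2_inner_elem[OF m F z(1)])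
    also have "\<dots> = load f (z, W)" by (simp add: load_def F_def[abs_def] l2_inner_uminus_left)
    finally show "bform t n x (u, M, q) zW = load f zW" by (simp add: zW)
  qed
  have "trial_norm n x (u, M, q) \<le> 3000 * l2_norm unit_ivl f"
  proof -
    have S0: "0 \<le> S" unfolding S_def by (simp add: l2_norm_nonneg)
    have fS: "l2_inner unit_ivl F F \<le> S\<^sup>2"
    proof -
      have "l2_inner unit_ivl F F = (l2_norm unit_ivl f)\<^sup>2" by (simp add: l2_norm_sq l2_inner_def F_def)
      also have "\<dots> \<le> S\<^sup>2" unfolding S_def by (intro power_mono) (auto simp: l2_norm_nonneg)
      finally show ?thesis .
    qed
    have uS: "l2_inner unit_ivl u u \<le> S\<^sup>2" and MS: "l2_inner unit_ivl M M \<le> S\<^sup>2"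
      using l2_inner_le_of_bounded[OF L(1) _ bd(1)] l2_inner_le_of_bounded[OF L(2) _ bd(3)] by auto
    \<comment> \<open>Bounded through (t^2 F - M)^2 <= 2 F^2 + 2 M^2 with t^2 <= 1.\<close>
    have u2: "l2_inner unit_ivl (\<lambda>s. t\<^sup>2 * F s + 0 - M s) (\<lambda>s. t\<^sup>2 * F s + 0 - M s) \<le> 4 * S\<^sup>2"
    proof -
      have T: "0 \<le> t\<^sup>2" "t\<^sup>2 \<le> 1" using t by (auto simp: power_le_one)
      have le: "(t\<^sup>2 * F s + 0 - M s) * (t\<^sup>2 * F s + 0 - M s) \<le> 2 * (F s * F s) + 2 * (M s * M s)" for s
      proof -
        have "(t\<^sup>2 * F s - M s)\<^sup>2 \<le> 2 * (t\<^sup>2 * F s)\<^sup>2 + 2 * (M s)\<^sup>2"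
          using zero_le_power2[of "t\<^sup>2 * F s + M s"] by (simp add: power2_sum power2_diff)
        also have "(t\<^sup>2 * F s)\<^sup>2 \<le> (F s)\<^sup>2"
          unfolding power_mult_distrib
          by (rule mult_left_le_one_le[OF zero_le_power2 zero_le_power2 power_le_one[OF T]])
        finally show ?thesis by (simp add: power2_eq_square)
      qed
      have int: "(\<lambda>s. 2 * (F s * F s)) integrable_on {0..1}" "(\<lambda>s. 2 * (M s * M s)) integrable_on {0..1}"
        using integrable_on_cmult_left[OF l2_inner_Ioo(2)[OF F F], of 2]
          integrable_on_cmult_left[OF l2_inner_Ioo(2)[OF L(2,2)], of 2] by simp_all
      have "integral {0..1} (\<lambda>s. (t\<^sup>2 * F s + 0 - M s) * (t\<^sup>2 * F s + 0 - M s))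
        \<le> integral {0..1} (\<lambda>s. 2 * (F s * F s) + 2 * (M s * M s))"
        by (rule integral_le[OF l2_inner_Ioo(2)[OF L(3,3)] integrable_add[OF int] le])
      also have "\<dots> = 2 * l2_inner unit_ivl F F + 2 * l2_inner unit_ivl M M"
        unfolding l2_inner_Ioo(1)[OF F F] l2_inner_Ioo(1)[OF L(2,2)]
        using Henstock_Kurzweil_Integration.integral_add[OF int] by simp
      finally show ?thesis unfolding l2_inner_Ioo(1)[OF L(3,3)] using fS MS by linarith
    qed
    have "trace_norm_sq n x q = (\<Sum>j = 1..n. elem_trace_norm_sq (x j - x (j - 1)) (trace1 n x u j))
      + (\<Sum>j = 1..n. elem_trace_norm_sq (x j - x (j - 1)) (trace1 n x M j))"
      by (simp add: trace_norm_sq_def q_def trace2_def sum.distrib)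
    \<comment> \<open>The second derivative of u has squared norm at most 4 S^2, that of M, namely
      F, at most S^2.\<close>
    also have "\<dots> \<le> (2 * S\<^sup>2 + 4 * (4 * S\<^sup>2)) + (2 * S\<^sup>2 + 4 * S\<^sup>2)"
      using sum_elem_trace_norm_sq_le[OF m u bd(1,2)] sum_elem_trace_norm_sq_le[OF m M bd(3,4)] u2 fS
      by linarith
    \<comment> \<open>The terms add up to 26 S^2, rounded up to a perfect square for the
      root.\<close>
    finally have "(l2_norm unit_ivl u)\<^sup>2 + (l2_norm unit_ivl M)\<^sup>2 + trace_norm_sq n x q \<le> 36 * S\<^sup>2"
      using uS MS zero_le_power2[of S] unfolding l2_norm_sq by linarith
    also have "36 * S\<^sup>2 = (6 * S)\<^sup>2" by (simp add: power_mult_distrib)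
    finally have "trial_norm n x (u, M, q) \<le> sqrt ((6 * S)\<^sup>2)"
      unfolding trial_norm_def prod.case by (rule real_sqrt_le_mono)
    then show ?thesis unfolding real_sqrt_abs using S0 by (simp add: S_def)
  qed
  moreover have "ae_eq unit_ivl (\<lambda>s. - wderiv 2 unit_ivl M s) f"
    using h2_rep_wderiv(2)[OF zero_less_one M] unfolding ae_eq_def by eventually_elim (simp add: F_def)
  moreover have "ae_eq unit_ivl (\<lambda>s. M s - t\<^sup>2 * wderiv 2 unit_ivl M s + wderiv 2 unit_ivl u s) (\<lambda>s. 0)"
    using h2_rep_wderiv(2)[OF zero_less_one M] h2_rep_wderiv(2)[OF zero_less_one u]
    unfolding ae_eq_def by eventually_elim (simp add: algebra_simps)
  moreover have "ae_eq unit_ivl u' u \<and> ae_eq unit_ivl M' M \<and> q' = q"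
    if "solves a t n x f (u', M', q')" for u' M' q'
    using solves_L2_part_unique[OF m t that sol] solves_trace_unique[OF m t that sol] by simp
  ultimately show "\<exists>u M q. solves a t n x f (u, M, q) \<and>
      (\<forall>u' M' q'. solves a t n x f (u', M', q') \<longrightarrow>
         ae_eq unit_ivl u' u \<and> ae_eq unit_ivl M' M \<and> q' = q) \<and>
      trial_norm n x (u, M, q) \<le> 3000 * l2_norm unit_ivl f \<and>
      u \<in> H2 unit_ivl \<and> M \<in> H2 unit_ivl \<and>
      ae_eq unit_ivl (\<lambda>s. - wderiv 2 unit_ivl M s) f \<and>
      ae_eq unit_ivl (\<lambda>s. M s - t\<^sup>2 * wderiv 2 unit_ivl M s + wderiv 2 unit_ivl u s) (\<lambda>s. 0) \<and>
      q = trace2 n x (u, M)"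
    using sol H q_def by (intro exI[of _ u] exI[of _ M] exI[of _ q]) blast
qed

end
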